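(* Let $K=\mathbb{Q}(\zeta_7+\zeta_7^{-1})$, where $\zeta_7$ is a primitive seventh root of unity, and let $\mathcal{O}_K$ be its ring of integers. The quadratic form \[ x^2+xy+y^2+yz-xw+z^2+zw+w^2 \] is universal over $K$, i.e. for every totally positive $\lambda\in\mathcal{O}_K$ there exist $x,y,z,w\in\mathcal{O}_K$ with $x^2+xy+y^2+yz-xw+z^2+zw+w^2=\lambda$.
   Context: An element $\lambda$ of a totally real field $K$ is totally positive if $\sigma(\lambda)>0$ for every real embedding $\sigma$ of $K$. *)

theory Defs
  imports Complex_Main
    "HOL-Computational_Algebra.Polynomial"
    "HOL-Algebra.Generated_Fields"
    "HOL-Algebra.Algebraic_Closure_Type"
begin

definition primitive_root_of_unity :: "nat \<Rightarrow> 'a::field \<Rightarrow> bool" where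
  "primitive_root_of_unity n z \<longleftrightarrow>
     0 < n \<and> z ^ n = 1 \<and> (\<forall>k. 0 < k \<and> k < n \<longrightarrow> z ^ k \<noteq> 1)"

text \<open>Number fields are represented as subsets of the complex numbers.\<close>

definition rat_adjoin :: "complex \<Rightarrow> complex set" where
  "rat_adjoin a = generate_field (ring_of_type_algebra :: complex ring) (\<rat> \<union> {a})"

definition ring_of_integers :: "complex set \<Rightarrow> complex set" where
  "ring_of_integers K = {x \<in> K. algebraic_int x}"

text \<open>An element of \<open>ring_hom\<close> preserves \<open>1\<close>, so it is automatically injective when its
  domain is a field. Its values outside \<open>K\<close> are unconstrained and irrelevant.\<close>

definition real_embeddings :: "complex set \<Rightarrow> (complex \<Rightarrow> real) set" where
  "real_embeddings K =
     ring_hom ((ring_of_type_algebra :: complex ring)\<lparr>carrier := K\<rparr>)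
              (ring_of_type_algebra :: real ring)"

definition totally_positive :: "complex set \<Rightarrow> complex \<Rightarrow> bool" where
  "totally_positive K l \<longleftrightarrow> l \<in> K \<and> (\<forall>\<sigma>\<in>real_embeddings K. \<sigma> l > 0)"

end

theory Submission
  imports Defs "HOL-Number_Theory.Euler_Criterion" "HOL-Library.Product_Plus"
begin

text \<open>The form is the reduced norm of the Hurwitz order \<open>O\<close> of \<open>K\<close>-quaternions, hence
  multiplicative. The ring \<open>\<int>[\<rho>]\<close>, \<open>\<rho> = \<zeta> + \<zeta>\<inverse>\<close>, is Euclidean, hence integrally closed, and a
  totally positive \<open>\<lambda>\<close> factors into rational primes, which are reduced norms of Hurwitz
  quaternions, and totally positive divisors of elements \<open>\<rho> - k\<close> with \<open>k \<in> \<int>\<close>. For such a divisor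
  \<open>\<lambda>\<close> choose a Hurwitz quaternion \<open>\<beta>\<close> of norm \<open>N(\<lambda>)\<close>. On the lattice generated by \<open>\<beta>\<close>, \<open>\<rho> - k\<close>
  and \<open>\<rho>\<^sup>2 - k\<^sup>2\<close> over the Hurwitz quaternions the Hermitian form \<open>Tr(u v\<^sup>*/\<lambda>)\<close> is integral of
  determinant 49 and has rank one modulo 7; Hermite reduction then gives a nonzero vector of norm
  at most 6. Hence \<open>\<lambda>\<mu>\<close> is a reduced norm for some totally positive \<open>\<mu>\<close> of trace at most 6, and
  such a \<open>\<mu>\<close> is the square of a unit or equal to 2. In the latter case the factor \<open>1 + i\<close> can be
  split off.\<close>

section \<open>The cubic ring\<close>

text \<open>\<open>Cubic a b c\<close> stands for \<open>a + b\<rho> + c\<rho>\<^sup>2\<close>, where \<open>\<rho> = \<zeta> + \<zeta>\<inverse>\<close> is a root of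
  \<open>X\<^sup>3 + X\<^sup>2 - 2X - 1\<close>.\<close>

datatype cubic = Cubic (cf0: int) (cf1: int) (cf2: int)

lemma cubic_eq_iff: "x = y \<longleftrightarrow> cf0 x = cf0 y \<and> cf1 x = cf1 y \<and> cf2 x = cf2 y"
  by (cases x; cases y) simp

instantiation cubic :: comm_ring_1
begin

definition "0 = Cubic 0 0 0"
definition "1 = Cubic 1 0 0"
definition "x + y = Cubic (cf0 x + cf0 y) (cf1 x + cf1 y) (cf2 x + cf2 y)"
definition "x - y = Cubic (cf0 x - cf0 y) (cf1 x - cf1 y) (cf2 x - cf2 y)"
definition "- x = Cubic (- cf0 x) (- cf1 x) (- cf2 x)"
definition "x * y =
  (let p0 = cf0 x * cf0 y; p1 = cf0 x * cf1 y + cf1 x * cf0 y;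
       p2 = cf0 x * cf2 y + cf1 x * cf1 y + cf2 x * cf0 y;
       p3 = cf1 x * cf2 y + cf2 x * cf1 y; p4 = cf2 x * cf2 y
   in Cubic (p0 + p3 - p4) (p1 + 2 * p3 - p4) (p2 - p3 + 3 * p4))"

instance
  by standard
    (auto simp: zero_cubic_def one_cubic_def plus_cubic_def minus_cubic_def uminus_cubic_def
      times_cubic_def Let_def algebra_simps)

end

lemma cubic_sel [simp]:
  "cf0 0 = 0" "cf1 0 = 0" "cf2 0 = 0"
  "cf0 1 = 1" "cf1 1 = 0" "cf2 1 = 0"
  "cf0 (x + y) = cf0 x + cf0 y" "cf1 (x + y) = cf1 x + cf1 y" "cf2 (x + y) = cf2 x + cf2 y"
  "cf0 (x - y) = cf0 x - cf0 y" "cf1 (x - y) = cf1 x - cf1 y" "cf2 (x - y) = cf2 x - cf2 y"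
  "cf0 (- x) = - cf0 x" "cf1 (- x) = - cf1 x" "cf2 (- x) = - cf2 x"
  by (simp_all add: zero_cubic_def one_cubic_def plus_cubic_def minus_cubic_def uminus_cubic_def)

lemma cubic_sel_times:
  "cf0 (x * y) = cf0 x * cf0 y + (cf1 x * cf2 y + cf2 x * cf1 y) - cf2 x * cf2 y"
  "cf1 (x * y) = cf0 x * cf1 y + cf1 x * cf0 y + 2 * (cf1 x * cf2 y + cf2 x * cf1 y)
     - cf2 x * cf2 y"
  "cf2 (x * y) = cf0 x * cf2 y + cf1 x * cf1 y + cf2 x * cf0 y
     - (cf1 x * cf2 y + cf2 x * cf1 y) + 3 * (cf2 x * cf2 y)"
  by (simp_all add: times_cubic_def Let_def)

lemma of_nat_cubic: "of_nat n = Cubic (int n) 0 0"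
  by (induction n) (auto simp: cubic_eq_iff)

lemma of_int_cubic: "of_int k = Cubic k 0 0"
  by (cases k) (auto simp: cubic_eq_iff of_nat_cubic)

lemma cubic_sel_of_int [simp]: "cf0 (of_int k) = k" "cf1 (of_int k) = 0" "cf2 (of_int k) = 0"
  by (simp_all add: of_int_cubic)

lemma cubic_sel_numeral [simp]:
  "cf0 (numeral k) = numeral k" "cf1 (numeral k) = 0" "cf2 (numeral k) = 0"
  using cubic_sel_of_int[of "numeral k"] by simp_all

instance cubic :: ring_char_0
  by standard (auto simp: inj_def of_nat_cubic)

lemma of_int_dvd_cubic_iff:
  "(of_int k :: cubic) dvd x \<longleftrightarrow> k dvd cf0 x \<and> k dvd cf1 x \<and> k dvd cf2 x"
proof
  assume "of_int k dvd x"
  then show "k dvd cf0 x \<and> k dvd cf1 x \<and> k dvd cf2 x"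
    by (auto simp: cubic_sel_times elim!: dvdE)
next
  assume "k dvd cf0 x \<and> k dvd cf1 x \<and> k dvd cf2 x"
  then obtain a b c where "cf0 x = k * a" "cf1 x = k * b" "cf2 x = k * c"
    by (auto elim!: dvdE)
  then have "x = of_int k * Cubic a b c"
    by (auto simp: cubic_eq_iff cubic_sel_times)
  then show "of_int k dvd x"
    by simp
qed

lemma two_dvd_cubic_iff: "(2 :: cubic) dvd x \<longleftrightarrow> even (cf0 x) \<and> even (cf1 x) \<and> even (cf2 x)"
  using of_int_dvd_cubic_iff[of 2 x] by simp

lemma of_int_dvd_of_int_cubic_iff: "(of_int k :: cubic) dvd of_int m \<longleftrightarrow> k dvd m"
  by (simp add: of_int_dvd_cubic_iff)

definition cubic_rho :: cubic where
  "cubic_rho = Cubic 0 1 0"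

lemma cubic_sel_rho [simp]: "cf0 cubic_rho = 0" "cf1 cubic_rho = 1" "cf2 cubic_rho = 0"
  by (simp_all add: cubic_rho_def)

subsection \<open>Galois conjugation, trace and norm\<close>

text \<open>The automorphism \<open>\<rho> \<mapsto> \<rho>\<^sup>2 - 2\<close>.\<close>

definition cubic_conj :: "cubic \<Rightarrow> cubic" where
  "cubic_conj x = Cubic (cf0 x - 2 * cf1 x + 3 * cf2 x) (- cf2 x) (cf1 x - cf2 x)"

lemma cubic_sel_conj [simp]:
  "cf0 (cubic_conj x) = cf0 x - 2 * cf1 x + 3 * cf2 x" "cf1 (cubic_conj x) = - cf2 x"
  "cf2 (cubic_conj x) = cf1 x - cf2 x"
  by (simp_all add: cubic_conj_def)

lemma cubic_conj_conj_conj: "cubic_conj (cubic_conj (cubic_conj x)) = x"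
  by (simp add: cubic_eq_iff)

lemma cubic_conj_mult: "cubic_conj (x * y) = cubic_conj x * cubic_conj y"
  by (simp add: cubic_eq_iff cubic_sel_times algebra_simps)

definition cubic_trace :: "cubic \<Rightarrow> int" where
  "cubic_trace x = 3 * cf0 x - cf1 x + 5 * cf2 x"

definition cubic_sym2 :: "cubic \<Rightarrow> int" where
  "cubic_sym2 x = (let a = cf0 x; b = cf1 x; c = cf2 x in
     3 * a^2 - 2 * a * b + 10 * a * c - 2 * b^2 - b * c + 6 * c^2)"

definition cubic_norm :: "cubic \<Rightarrow> int" where
  "cubic_norm x = (let a = cf0 x; b = cf1 x; c = cf2 x in
     a^3 - a^2 * b + 5 * a^2 * c - 2 * a * b^2 - a * b * c + 6 * a * c^2
     + b^3 - b^2 * c - 2 * b * c^2 + c^3)"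

definition cubic_adj :: "cubic \<Rightarrow> cubic" where
  "cubic_adj x = cubic_conj x * cubic_conj (cubic_conj x)"

lemma cubic_trace_conj: "of_int (cubic_trace x) = x + cubic_conj x + cubic_conj (cubic_conj x)"
  unfolding of_int_cubic by (simp add: cubic_eq_iff cubic_trace_def)

lemma cubic_sym2_conj:
  "of_int (cubic_sym2 x) =
    x * cubic_conj x + x * cubic_conj (cubic_conj x) + cubic_conj x * cubic_conj (cubic_conj x)"
  unfolding of_int_cubic
  by (simp add: cubic_eq_iff cubic_sym2_def cubic_sel_times Let_def algebra_simps
      power2_eq_square power3_eq_cube)

lemma cubic_norm_conj: "of_int (cubic_norm x) = x * cubic_conj x * cubic_conj (cubic_conj x)"
  unfolding of_int_cubic
  by (simp add: cubic_eq_iff cubic_norm_def cubic_sel_times Let_def algebra_simps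
      power2_eq_square power3_eq_cube)

lemma cubic_norm_adj: "of_int (cubic_norm x) = x * cubic_adj x"
  by (simp add: cubic_norm_conj cubic_adj_def mult.assoc)

lemma cubic_trace_linear:
  "cubic_trace (x + y) = cubic_trace x + cubic_trace y"
  "cubic_trace (x - y) = cubic_trace x - cubic_trace y"
  "cubic_trace (- x) = - cubic_trace x" "cubic_trace 0 = 0"
  by (simp_all add: cubic_trace_def)

lemma cubic_trace_of_int_mult: "cubic_trace (of_int k * x) = k * cubic_trace x"
  by (simp add: cubic_trace_def cubic_sel_times algebra_simps)

lemma cubic_norm_mult: "cubic_norm (x * y) = cubic_norm x * cubic_norm y"
proof -
  have "(of_int (cubic_norm (x * y)) :: cubic) = of_int (cubic_norm x * cubic_norm y)"
    by (simp only: cubic_norm_conj of_int_mult) (simp add: cubic_conj_mult algebra_simps)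
  then show ?thesis
    by (simp only: of_int_eq_iff)
qed

lemma cubic_norm_of_int [simp]: "cubic_norm (of_int k) = k ^ 3"
  by (simp add: cubic_norm_def Let_def)

lemma cubic_norm_0 [simp]: "cubic_norm 0 = 0" and cubic_norm_1 [simp]: "cubic_norm 1 = 1"
  by (simp_all add: cubic_norm_def Let_def)

lemma cubic_norm_numeral [simp]: "cubic_norm (numeral k) = numeral k ^ 3"
  using cubic_norm_of_int[of "numeral k"] by simp

lemma cubic_norm_adj_eq: "cubic_norm (cubic_adj x) = (cubic_norm x)\<^sup>2"
proof -
  have "cubic_norm (cubic_conj y) = cubic_norm y" for y
    by (simp add: cubic_norm_def Let_def algebra_simps power2_eq_square power3_eq_cube)
  then show ?thesis
    by (simp add: cubic_adj_def cubic_norm_mult power2_eq_square)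
qed

lemma cubic_norm_cong:
  assumes "of_int k dvd x - y"
  shows "k dvd cubic_norm x - cubic_norm y"
proof -
  obtain z where x: "x = y + of_int k * z"
    using assms by (metis add.commute diff_add_cancel dvdE)
  define y' y'' z' z'' where "y' = cubic_conj y" and "y'' = cubic_conj y'"
    and "z' = cubic_conj z" and "z'' = cubic_conj z'"
  have conj: "cubic_conj (u + of_int k * v) = cubic_conj u + of_int k * cubic_conj v" for u v
    by (simp add: cubic_eq_iff cubic_sel_times algebra_simps)
  have "of_int (cubic_norm x) =
      (y + of_int k * z) * (y' + of_int k * z') * (y'' + of_int k * z'')"
    by (simp only: cubic_norm_conj x conj y'_def y''_def z'_def z''_def)
  moreover have "of_int (cubic_norm y) = y * y' * y''"
    by (simp only: cubic_norm_conj y'_def y''_def)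
  ultimately have "(of_int (cubic_norm x - cubic_norm y) :: cubic) = of_int k *
      (z * (y' + of_int k * z') * (y'' + of_int k * z'') + y * z' * (y'' + of_int k * z'')
        + y * y' * z'')"
    by (simp add: algebra_simps)
  then show ?thesis
    by (metis dvd_triv_left of_int_dvd_of_int_cubic_iff)
qed

text \<open>The prime 2 is inert.\<close>

lemma even_cubic_norm_imp_two_dvd:
  assumes "even (cubic_norm x)"
  shows "2 dvd x"
  using assms unfolding two_dvd_cubic_iff
  by (cases "even (cf0 x)"; cases "even (cf1 x)"; cases "even (cf2 x)")
    (auto simp: cubic_norm_def Let_def)

lemma cubic_norm_eq_0_iff [simp]: "cubic_norm x = 0 \<longleftrightarrow> x = 0"
proof
  show "cubic_norm x = 0 \<Longrightarrow> x = 0"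
  proof (induction "nat (\<bar>cf0 x\<bar> + \<bar>cf1 x\<bar> + \<bar>cf2 x\<bar>)" arbitrary: x rule: less_induct)
    case less
    obtain y where y: "x = 2 * y"
      using even_cubic_norm_imp_two_dvd[of x] less.prems by (auto elim!: dvdE)
    have norm_y: "cubic_norm y = 0"
      using less.prems by (simp add: y cubic_norm_mult)
    show ?case
    proof (rule ccontr)
      assume "x \<noteq> 0"
      then have "nat (\<bar>cf0 y\<bar> + \<bar>cf1 y\<bar> + \<bar>cf2 y\<bar>) < nat (\<bar>cf0 x\<bar> + \<bar>cf1 x\<bar> + \<bar>cf2 x\<bar>)"
        unfolding y by (auto simp: cubic_eq_iff cubic_sel_times)
      then have "y = 0"
        using less.hyps norm_y by blast
      with y \<open>x \<noteq> 0\<close> show False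
        by simp
    qed
  qed
qed simp

instance cubic :: idom
proof
  fix x y :: cubic
  assume "x \<noteq> 0" "y \<noteq> 0"
  then have "cubic_norm (x * y) \<noteq> 0"
    by (simp add: cubic_norm_mult)
  then show "x * y \<noteq> 0"
    by auto
qed

lemma cubic_is_unit_iff: "(x :: cubic) dvd 1 \<longleftrightarrow> \<bar>cubic_norm x\<bar> = 1"
proof
  assume "x dvd 1"
  then show "\<bar>cubic_norm x\<bar> = 1"
    by (metis abs_zmult_eq_1 abs_one cubic_norm_1 cubic_norm_mult dvdE)
next
  assume "\<bar>cubic_norm x\<bar> = 1"
  then have "(of_int (cubic_norm x) :: cubic) dvd 1"
    by (metis of_int_1 of_int_dvd_of_int_cubic_iff zdvd1_eq)
  then show "x dvd 1"
    by (metis cubic_norm_adj dvd_mult_left)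
qed

subsection \<open>Evaluation at a root of the minimal polynomial\<close>

definition cubic_eval :: "'a::comm_ring_1 \<Rightarrow> cubic \<Rightarrow> 'a" where
  "cubic_eval r x = of_int (cf0 x) + of_int (cf1 x) * r + of_int (cf2 x) * r\<^sup>2"

definition cubic_poly :: "'a::comm_ring_1 \<Rightarrow> 'a" where
  "cubic_poly r = r ^ 3 + r\<^sup>2 - 2 * r - 1"

definition conj_root :: "'a::comm_ring_1 \<Rightarrow> 'a" where
  "conj_root r = r\<^sup>2 - 2"

lemma cubic_eval_add: "cubic_eval r (x + y) = cubic_eval r x + cubic_eval r y"
  by (simp add: cubic_eval_def algebra_simps)

lemma cubic_eval_diff: "cubic_eval r (x - y) = cubic_eval r x - cubic_eval r y"
  by (simp add: cubic_eval_def algebra_simps)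

lemma cubic_eval_uminus: "cubic_eval r (- x) = - cubic_eval r x"
  by (simp add: cubic_eval_def algebra_simps)

lemma cubic_eval_of_int [simp]: "cubic_eval r (of_int k) = of_int k"
  by (simp add: cubic_eval_def)

lemma cubic_eval_0 [simp]: "cubic_eval r 0 = 0" and cubic_eval_1 [simp]: "cubic_eval r 1 = 1"
  by (simp_all add: cubic_eval_def)

lemma cubic_eval_rho [simp]: "cubic_eval r cubic_rho = r"
  by (simp add: cubic_eval_def)

lemma cubic_poly_dvd_eval_mult:
  "cubic_poly r dvd cubic_eval r x * cubic_eval r y - cubic_eval r (x * y)"
proof
  show "cubic_eval r x * cubic_eval r y - cubic_eval r (x * y) = cubic_poly r *
      (of_int (cf2 x * cf2 y) * r + of_int (cf1 x * cf2 y + cf2 x * cf1 y - cf2 x * cf2 y))"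
    by (simp add: cubic_eval_def cubic_poly_def cubic_sel_times algebra_simps power2_eq_square
        power3_eq_cube)
qed

lemma cubic_poly_dvd_conj_root: "cubic_poly r dvd cubic_poly (conj_root r)"
proof
  show "cubic_poly (conj_root r) = cubic_poly r * (r ^ 3 - r\<^sup>2 - 2 * r + 1)"
    by (simp add: cubic_poly_def conj_root_def algebra_simps power2_eq_square power3_eq_cube)
qed

lemma cubic_poly_dvd_eval_conj:
  "cubic_poly r dvd cubic_eval (conj_root r) x - cubic_eval r (cubic_conj x)"
proof
  show "cubic_eval (conj_root r) x - cubic_eval r (cubic_conj x) =
      cubic_poly r * (of_int (cf2 x) * (r - 1))"
    by (simp add: cubic_eval_def cubic_poly_def conj_root_def algebra_simps power2_eq_square
        power3_eq_cube)
qed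

lemma cubic_poly_dvd_eval_norm:
  "cubic_poly r dvd cubic_eval r x * cubic_eval (conj_root r) x
    * cubic_eval (conj_root (conj_root r)) x - of_int (cubic_norm x)"
proof -
  let ?y = "cubic_conj x" and ?z = "cubic_conj (cubic_conj x)"
  define a b c where "a = cubic_eval r x" and "b = cubic_eval (conj_root r) x"
    and "c = cubic_eval (conj_root (conj_root r)) x"
  have b: "cubic_poly r dvd b - cubic_eval r ?y"
    unfolding b_def by (rule cubic_poly_dvd_eval_conj)
  have "cubic_poly r dvd (c - cubic_eval (conj_root r) ?y)
      + (cubic_eval (conj_root r) ?y - cubic_eval r ?z)"
    unfolding c_def
    by (intro dvd_add dvd_trans[OF cubic_poly_dvd_conj_root[of r]] cubic_poly_dvd_eval_conj)
  then have c: "cubic_poly r dvd c - cubic_eval r ?z"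
    by simp
  have "cubic_poly r dvd a * c * (b - cubic_eval r ?y) + a * cubic_eval r ?y * (c - cubic_eval r ?z)
      + (a * cubic_eval r ?y - cubic_eval r (x * ?y)) * cubic_eval r ?z
      + (cubic_eval r (x * ?y) * cubic_eval r ?z - cubic_eval r (x * ?y * ?z))"
    unfolding a_def
    by (intro dvd_add dvd_mult[OF b] dvd_mult[OF c] dvd_mult2[OF cubic_poly_dvd_eval_mult]
        cubic_poly_dvd_eval_mult)
  also have "cubic_eval r (x * ?y * ?z) = of_int (cubic_norm x)"
    by (simp flip: cubic_norm_conj)
  finally show ?thesis
    by (simp add: algebra_simps a_def b_def c_def)
qed

context
  fixes r :: "'a::comm_ring_1"
  assumes root: "cubic_poly r = 0"
begin

lemma cubic_poly_conj_root: "cubic_poly (conj_root r) = 0"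
  using cubic_poly_dvd_conj_root[of r] root by simp

lemma cubic_eval_mult: "cubic_eval r (x * y) = cubic_eval r x * cubic_eval r y"
  using cubic_poly_dvd_eval_mult[of r x y] root by simp

lemma cubic_eval_conj: "cubic_eval r (cubic_conj x) = cubic_eval (conj_root r) x"
  using cubic_poly_dvd_eval_conj[of r x] root by simp

end

lemma conj_root_conj_root_conj_root:
  assumes "cubic_poly r = 0"
  shows "conj_root (conj_root (conj_root r)) = r"
  using arg_cong[OF cubic_conj_conj_conj[of cubic_rho], of "cubic_eval r"] assms
  by (simp add: cubic_eval_conj cubic_poly_conj_root)

lemma cubic_eval_trace:
  assumes "cubic_poly r = 0"
  shows "of_int (cubic_trace x) =
    cubic_eval r x + cubic_eval (conj_root r) x + cubic_eval (conj_root (conj_root r)) x"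
  using arg_cong[OF cubic_trace_conj[of x], of "cubic_eval r"] assms
  by (simp add: cubic_eval_add cubic_eval_conj cubic_poly_conj_root)

lemma cubic_eval_sym2:
  assumes "cubic_poly r = 0"
  shows "of_int (cubic_sym2 x) = cubic_eval r x * cubic_eval (conj_root r) x
    + cubic_eval r x * cubic_eval (conj_root (conj_root r)) x
    + cubic_eval (conj_root r) x * cubic_eval (conj_root (conj_root r)) x"
  using arg_cong[OF cubic_sym2_conj[of x], of "cubic_eval r"] assms
  by (simp add: cubic_eval_add cubic_eval_mult cubic_eval_conj cubic_poly_conj_root)

lemma cubic_eval_norm:
  assumes "cubic_poly r = 0"
  shows "of_int (cubic_norm x) =
    cubic_eval r x * cubic_eval (conj_root r) x * cubic_eval (conj_root (conj_root r)) x"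
  using cubic_poly_dvd_eval_norm[of r x] assms by simp

lemma cubic_eval_eq_0_iff:
  assumes "cubic_poly (r :: 'a::{comm_ring_1,ring_char_0}) = 0"
  shows "cubic_eval r x = 0 \<longleftrightarrow> x = 0"
  using cubic_eval_norm[OF assms, of x] by auto

lemma cubic_poly_real_root_ge_1_exists: "\<exists>r::real. r \<ge> 1 \<and> cubic_poly r = 0"
proof -
  have "\<exists>r. 1 \<le> r \<and> r \<le> 2 \<and> cubic_poly r = (0::real)"
    unfolding cubic_poly_def by (intro IVT') (auto intro!: continuous_intros)
  then show ?thesis
    by blast
qed

section \<open>Euclidean division\<close>

lemma euclidean_ring_ideal_principal:
  fixes I :: "'a::euclidean_ring set"
  assumes zero: "0 \<in> I" and add: "\<And>x y. x \<in> I \<Longrightarrow> y \<in> I \<Longrightarrow> x + y \<in> I"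
    and mult: "\<And>a x. x \<in> I \<Longrightarrow> a * x \<in> I"
  obtains g where "g \<in> I" "\<And>x. x \<in> I \<Longrightarrow> g dvd x"
proof (cases "I = {0}")
  case True
  then show thesis
    using that[of 0] by simp
next
  case False
  then obtain y where "y \<in> I \<and> y \<noteq> 0"
    using zero by blast
  then obtain g where g: "g \<in> I" "g \<noteq> 0"
    and least: "\<And>x. x \<in> I \<Longrightarrow> x \<noteq> 0 \<Longrightarrow> euclidean_size g \<le> euclidean_size x"
    using ex_has_least_nat[of "\<lambda>x. x \<in> I \<and> x \<noteq> 0" y euclidean_size] by blast
  have "g dvd x" if "x \<in> I" for x
  proof -
    have "x mod g = x + - (x div g) * g"
      by (simp flip: minus_div_mult_eq_mod)
    then have "x mod g \<in> I"
      using add mult that g(1) by metis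
    then have "x mod g = 0"
      using least[of "x mod g"] mod_size_less[OF g(2), of x] by linarith
    then show ?thesis
      by (rule mod_0_imp_dvd)
  qed
  with g(1) show thesis
    by (rule that)
qed

lemma euclidean_ring_bezout:
  fixes a b :: "'a::euclidean_ring"
  obtains g u v where "g = u * a + v * b" "g dvd a" "g dvd b"
proof -
  define I where "I = {x. \<exists>u v. x = u * a + v * b}"
  have in_I: "u * a + v * b \<in> I" for u v
    by (auto simp: I_def)
  obtain g where g: "g \<in> I" "\<And>x. x \<in> I \<Longrightarrow> g dvd x"
  proof (rule euclidean_ring_ideal_principal)
    show "0 \<in> I"
      using in_I[of 0 0] by simp
  next
    fix x y assume "x \<in> I" "y \<in> I"
    then obtain u v u' v' where "x = u * a + v * b" "y = u' * a + v' * b"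
      by (auto simp: I_def)
    then show "x + y \<in> I"
      using in_I[of "u + u'" "v + v'"] by (simp add: algebra_simps)
  next
    fix c x assume "x \<in> I"
    then obtain u v where "x = u * a + v * b"
      by (auto simp: I_def)
    then show "c * x \<in> I"
      using in_I[of "c * u" "c * v"] by (simp add: algebra_simps)
  qed blast
  have "g dvd a" "g dvd b"
    using g(2) in_I[of 1 0] in_I[of 0 1] by simp_all
  with g(1) show thesis
    using that by (auto simp: I_def)
qed

lemma cubic_trace_square:
  "6 * cubic_trace (x * x) = 2 * (3 * cf0 x - cf1 x + 5 * cf2 x)\<^sup>2 + 7 * (2 * cf1 x - cf2 x)\<^sup>2
    + 21 * (cf2 x)\<^sup>2"
  by (simp add: cubic_trace_def cubic_sel_times algebra_simps power2_eq_square)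

lemma cubic_trace_square_nonneg: "cubic_trace (x * x) \<ge> 0"
proof -
  have "6 * cubic_trace (x * x) \<ge> 0"
    unfolding cubic_trace_square by simp
  then show ?thesis
    by simp
qed

lemma arith_geo_mean_3:
  fixes a b c :: "'a::linordered_idom"
  assumes "a \<ge> 0" "b \<ge> 0" "c \<ge> 0"
  shows "27 * (a * b * c) \<le> (a + b + c) ^ 3"
proof -
  have "a * (b - c)\<^sup>2 \<ge> 0" "b * (a - c)\<^sup>2 \<ge> 0" "c * (a - b)\<^sup>2 \<ge> 0"
    "(a + b + c) * ((a - b)\<^sup>2 + (b - c)\<^sup>2 + (a - c)\<^sup>2) \<ge> 0"
    using assms by simp_all
  then show ?thesis
    by (simp add: algebra_simps power2_eq_square power3_eq_cube)
qed

lemma cubic_norm_trace_bound: "27 * (cubic_norm x)\<^sup>2 \<le> cubic_trace (x * x) ^ 3"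
proof -
  obtain r :: real where r: "cubic_poly r = 0"
    using cubic_poly_real_root_ge_1_exists by blast
  define a b c where "a = cubic_eval r x" and "b = cubic_eval (conj_root r) x"
    and "c = cubic_eval (conj_root (conj_root r)) x"
  have "real_of_int (27 * (cubic_norm x)\<^sup>2) = 27 * (a\<^sup>2 * b\<^sup>2 * c\<^sup>2)"
    by (simp add: cubic_eval_norm[OF r] a_def b_def c_def power_mult_distrib)
  also have "\<dots> \<le> (a\<^sup>2 + b\<^sup>2 + c\<^sup>2) ^ 3"
    by (intro arith_geo_mean_3) simp_all
  also have "\<dots> = real_of_int (cubic_trace (x * x) ^ 3)"
    using r by (simp add: cubic_eval_trace cubic_eval_mult cubic_poly_conj_root a_def b_def c_def
        power2_eq_square)
  finally show ?thesis
    by (simp only: of_int_le_iff)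
qed

lemma int_nearest_multiple:
  fixes x n :: int
  assumes "n > 0"
  obtains m where "2 * \<bar>x - n * m\<bar> \<le> n"
proof
  define m where "m = (2 * x + n) div (2 * n)"
  have "2 * x + n - 2 * (n * m) = (2 * x + n) mod (2 * n)"
    by (simp add: m_def minus_mult_div_eq_mod flip: mult.assoc)
  then have "0 \<le> 2 * x + n - 2 * (n * m)" "2 * x + n - 2 * (n * m) < 2 * n"
    using assms by simp_all
  then have "\<bar>2 * (x - n * m)\<bar> \<le> n"
    by (simp add: abs_le_iff algebra_simps)
  then show "2 * \<bar>x - n * m\<bar> \<le> n"
    by (simp only: abs_mult abs_numeral)
qed

text \<open>Nearest-plane rounding along the diagonalisation of the trace form in \<open>cubic_trace_square\<close>;
  the constant is \<open>67/24 < 3\<close>.\<close>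

lemma cubic_nearest_multiple:
  assumes "n > 0"
  obtains q where "cubic_trace ((v - of_int n * q) * (v - of_int n * q)) < 3 * n\<^sup>2"
proof -
  obtain k where k: "2 * \<bar>cf2 v - n * k\<bar> \<le> n"
    using int_nearest_multiple[OF assms] .
  define w2 where "w2 = cf2 v - n * k"
  obtain j where j: "2 * \<bar>2 * cf1 v - w2 - 2 * n * j\<bar> \<le> 2 * n"
    using int_nearest_multiple[of "2 * n"] assms by auto
  define w1 where "w1 = cf1 v - n * j"
  obtain i where i: "2 * \<bar>3 * cf0 v - w1 + 5 * w2 - 3 * n * i\<bar> \<le> 3 * n"
    using int_nearest_multiple[of "3 * n"] assms by auto
  define w0 where "w0 = cf0 v - n * i"
  define w where "w = v - of_int n * Cubic i j k"
  have w: "cf0 w = w0" "cf1 w = w1" "cf2 w = w2"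
    by (simp_all add: w_def w0_def w1_def w2_def cubic_sel_times)
  have "2 * \<bar>w2\<bar> \<le> n" "\<bar>2 * w1 - w2\<bar> \<le> n" "2 * \<bar>3 * w0 - w1 + 5 * w2\<bar> \<le> 3 * n"
    using i j k by (simp_all add: w0_def w1_def w2_def algebra_simps)
  then have "(2 * w2)\<^sup>2 \<le> n\<^sup>2" "(2 * w1 - w2)\<^sup>2 \<le> n\<^sup>2" "(2 * (3 * w0 - w1 + 5 * w2))\<^sup>2 \<le> (3 * n)\<^sup>2"
    using assms by (simp_all only: power2_le_iff_abs_le abs_mult)
  moreover have "24 * cubic_trace (w * w) =
      2 * (2 * (3 * w0 - w1 + 5 * w2))\<^sup>2 + 28 * (2 * w1 - w2)\<^sup>2 + 21 * (2 * w2)\<^sup>2"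
    using cubic_trace_square[of w] unfolding w power_mult_distrib by simp
  moreover have "n\<^sup>2 > 0" "(3 * n)\<^sup>2 = 9 * n\<^sup>2"
    using assms by (simp_all add: power_mult_distrib)
  ultimately have "cubic_trace (w * w) < 3 * n\<^sup>2"
    by linarith
  then show thesis
    unfolding w_def by (rule that)
qed

lemma cubic_division:
  assumes "b \<noteq> 0"
  shows "\<exists>q. \<bar>cubic_norm (a - q * b)\<bar> < \<bar>cubic_norm b\<bar>"
proof -
  define n where "n = \<bar>cubic_norm b\<bar>"
  have "n > 0"
    using assms by (simp add: n_def)
  define v where "v = a * cubic_adj b"
  obtain q where q: "cubic_trace ((v - of_int n * q) * (v - of_int n * q)) < 3 * n\<^sup>2"
    using cubic_nearest_multiple[OF \<open>n > 0\<close>] .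
  define w where "w = v - of_int n * q"
  define s where "s = of_int (sgn (cubic_norm b)) * q"
  have "of_int n = (of_int (sgn (cubic_norm b)) * (b * cubic_adj b) :: cubic)"
    by (simp add: n_def abs_sgn mult.commute flip: cubic_norm_adj)
  then have "w = (a - s * b) * cubic_adj b"
    by (simp add: w_def v_def s_def algebra_simps)
  then have norm_w: "cubic_norm w = cubic_norm (a - s * b) * n\<^sup>2"
    by (simp add: cubic_norm_mult cubic_norm_adj_eq n_def)
  have "27 * (cubic_norm w)\<^sup>2 \<le> cubic_trace (w * w) ^ 3"
    by (rule cubic_norm_trace_bound)
  also have "\<dots> < (3 * n\<^sup>2) ^ 3"
    using q by (intro power_strict_mono) (simp_all add: w_def cubic_trace_square_nonneg)
  also have "\<dots> = 27 * ((n\<^sup>2)\<^sup>2 * n\<^sup>2)"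
    by (simp add: power2_eq_square power3_eq_cube)
  finally have "(n\<^sup>2)\<^sup>2 * (cubic_norm (a - s * b))\<^sup>2 < (n\<^sup>2)\<^sup>2 * n\<^sup>2"
    by (simp add: norm_w power_mult_distrib mult.commute)
  then have "(cubic_norm (a - s * b))\<^sup>2 < n\<^sup>2"
    by (rule mult_left_less_imp_less) simp
  then have "\<bar>cubic_norm (a - s * b)\<bar> < n"
    using \<open>n > 0\<close> abs_le_square_iff[of n "cubic_norm (a - s * b)"] by auto
  then show ?thesis
    unfolding n_def by blast
qed

instantiation cubic :: euclidean_ring
begin

definition "(a :: cubic) div b =
  (if b = 0 then 0 else SOME q. \<bar>cubic_norm (a - q * b)\<bar> < \<bar>cubic_norm b\<bar>)"
definition "(a :: cubic) mod b = a - a div b * b"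
definition "euclidean_size (a :: cubic) = nat \<bar>cubic_norm a\<bar>"

instance
proof
  fix a b :: cubic
  have less: "\<bar>cubic_norm (a mod b)\<bar> < \<bar>cubic_norm b\<bar>" if "b \<noteq> 0" for a b :: cubic
    using someI_ex[OF cubic_division[OF that, of a]] that
    by (simp add: modulo_cubic_def divide_cubic_def)
  show "a * b div b = a" if "b \<noteq> 0"
  proof -
    have "(a * b) mod b = (a - a * b div b) * b"
      by (simp add: modulo_cubic_def left_diff_distrib)
    then have "\<bar>cubic_norm (a - a * b div b)\<bar> * \<bar>cubic_norm b\<bar> < 1 * \<bar>cubic_norm b\<bar>"
      using less[OF that, of "a * b"] by (simp add: cubic_norm_mult abs_mult)
    then show ?thesis
      using that by (simp only: mult_less_cancel_right) auto
  qed
  show "a div 0 = 0" "a div b * b + a mod b = a" "euclidean_size (0 :: cubic) = 0"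
    by (simp_all add: divide_cubic_def modulo_cubic_def euclidean_size_cubic_def)
  show "euclidean_size (a mod b) < euclidean_size b" if "b \<noteq> 0"
    using less[OF that] that by (simp add: euclidean_size_cubic_def)
  show "euclidean_size a \<le> euclidean_size (a * b)" if "b \<noteq> 0"
  proof -
    have "1 \<le> \<bar>cubic_norm b\<bar>"
      using that by (simp add: int_one_le_iff_zero_less)
    then have "\<bar>cubic_norm a\<bar> * 1 \<le> \<bar>cubic_norm a\<bar> * \<bar>cubic_norm b\<bar>"
      by (intro mult_left_mono) simp_all
    then show ?thesis
      by (simp add: euclidean_size_cubic_def cubic_norm_mult abs_mult nat_mono)
  qed
qed

end

section \<open>Total positivity\<close>

definition cubic_totpos :: "cubic \<Rightarrow> bool" where
  "cubic_totpos x \<longleftrightarrow> (\<forall>r::real. cubic_poly r = 0 \<longrightarrow> cubic_eval r x > 0)"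

lemma cubic_real_roots:
  fixes r s :: real
  assumes "cubic_poly r = 0" "cubic_poly s = 0"
  shows "s = r \<or> s = conj_root r \<or> s = conj_root (conj_root r)"
proof -
  have conj: "conj_root (conj_root r) = 1 - r - r\<^sup>2 + cubic_poly r * (r - 1)"
    by (simp add: cubic_poly_def conj_root_def algebra_simps power2_eq_square power3_eq_cube)
  have "(s - r) * (s - conj_root r) * (s - (1 - r - r\<^sup>2)) =
      cubic_poly s + cubic_poly r * (r\<^sup>2 - 1 - r * s)"
    by (simp add: cubic_poly_def conj_root_def algebra_simps power2_eq_square power3_eq_cube)
  then have "(s - r) * (s - conj_root r) * (s - (1 - r - r\<^sup>2)) = 0"
    using assms by simp
  then show ?thesis
    using conj assms by auto
qed

lemma cubic_totpos_iff:
  fixes r :: real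
  assumes "cubic_poly r = 0"
  shows "cubic_totpos x \<longleftrightarrow> cubic_eval r x > 0 \<and> cubic_eval (conj_root r) x > 0 \<and>
    cubic_eval (conj_root (conj_root r)) x > 0"
proof
  assume "cubic_totpos x"
  then show "cubic_eval r x > 0 \<and> cubic_eval (conj_root r) x > 0 \<and>
    cubic_eval (conj_root (conj_root r)) x > 0"
    using assms by (simp add: cubic_totpos_def cubic_poly_conj_root)
next
  assume "cubic_eval r x > 0 \<and> cubic_eval (conj_root r) x > 0 \<and>
    cubic_eval (conj_root (conj_root r)) x > 0"
  then show "cubic_totpos x"
    unfolding cubic_totpos_def using cubic_real_roots[OF assms] by metis
qed

lemma cubic_totpos_imp:
  assumes "cubic_totpos x"
  shows "cubic_trace x > 0" "cubic_sym2 x > 0" "cubic_norm x > 0"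
proof -
  obtain r :: real where r: "cubic_poly r = 0"
    using cubic_poly_real_root_ge_1_exists by blast
  have "cubic_eval r x > 0" "cubic_eval (conj_root r) x > 0"
    "cubic_eval (conj_root (conj_root r)) x > 0"
    using assms cubic_totpos_iff[OF r] by simp_all
  then have "real_of_int (cubic_trace x) > 0" "real_of_int (cubic_sym2 x) > 0"
    "real_of_int (cubic_norm x) > 0"
    unfolding cubic_eval_trace[OF r] cubic_eval_sym2[OF r] cubic_eval_norm[OF r]
    by (simp_all add: add_pos_pos)
  then show "cubic_trace x > 0" "cubic_sym2 x > 0" "cubic_norm x > 0"
    by simp_all
qed

lemma cubic_totpos_divide:
  assumes "cubic_totpos (x * y)" "cubic_totpos x"
  shows "cubic_totpos y"
  using assms
  by (auto simp: cubic_totpos_def cubic_eval_mult zero_less_mult_iff dest: less_imp_not_less)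

lemma cubic_real_root_signs:
  fixes r :: real
  assumes "cubic_poly r = 0" "r \<ge> 1"
  shows "conj_root r < 0" "conj_root (conj_root r) < 0"
proof -
  have "r * (conj_root r * conj_root (conj_root r)) = 1"
    using cubic_eval_norm[OF assms(1), of cubic_rho] by (simp add: cubic_norm_def mult.assoc)
  then have "conj_root r * conj_root (conj_root r) > 0"
    using assms(2) zero_less_mult_pos[of r] by simp
  moreover have "r + conj_root r + conj_root (conj_root r) = -1"
    using cubic_eval_trace[OF assms(1), of cubic_rho] by (simp add: cubic_trace_def)
  ultimately show "conj_root r < 0" "conj_root (conj_root r) < 0"
    using assms(2) by (auto simp only: zero_less_mult_iff)
qed

text \<open>Up to sign, the conjugates of \<open>\<rho>\<close> realise all combinations of signs at the three real places.\<close>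

lemma cubic_unit_with_signs:
  fixes r :: real
  assumes r: "cubic_poly r = 0" "r \<ge> 1" and "a \<noteq> 0" "b \<noteq> 0" "c \<noteq> 0"
  shows "\<exists>e. e dvd 1 \<and> cubic_eval r e * a > 0 \<and> cubic_eval (conj_root r) e * b > 0
    \<and> cubic_eval (conj_root (conj_root r)) e * c > 0"
proof -
  define s t where "s = conj_root r" and "t = conj_root (conj_root r)"
  have signs: "r > 0" "s < 0" "t < 0"
    using cubic_real_root_signs[OF r] r(2) by (simp_all add: s_def t_def)
  define u v where "u = cubic_conj cubic_rho" and "v = cubic_conj (cubic_conj cubic_rho)"
  have eval: "cubic_eval r u = s" "cubic_eval s u = t" "cubic_eval t u = r"
    "cubic_eval r v = t" "cubic_eval s v = r" "cubic_eval t v = s"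
    using r(1) unfolding u_def v_def s_def t_def
    by (simp_all add: cubic_eval_conj cubic_poly_conj_root conj_root_conj_root_conj_root)
  have units: "e dvd 1" if "e \<in> {1, cubic_rho, u, v, -1, - cubic_rho, - u, - v}" for e
    using that by (auto simp: cubic_is_unit_iff cubic_norm_def u_def v_def)
  have "\<exists>e \<in> {1, cubic_rho, u, v, -1, - cubic_rho, - u, - v}.
      cubic_eval r e * a > 0 \<and> cubic_eval s e * b > 0 \<and> cubic_eval t e * c > 0"
    using signs assms(3-5) by (cases "a > 0"; cases "b > 0"; cases "c > 0")
      (simp_all add: eval cubic_eval_uminus zero_less_mult_iff)
  then show ?thesis
    using units unfolding s_def t_def by blast
qed

lemma cubic_totpos_associate:
  assumes "x \<noteq> 0"
  obtains e where "e dvd 1" "cubic_totpos (e * x)"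
proof -
  obtain r :: real where r: "cubic_poly r = 0" "r \<ge> 1"
    using cubic_poly_real_root_ge_1_exists by blast
  have "cubic_poly (conj_root r) = 0" "cubic_poly (conj_root (conj_root r)) = 0"
    using r(1) by (simp_all add: cubic_poly_conj_root)
  with r show thesis
    using cubic_unit_with_signs[OF r, of "cubic_eval r x" "cubic_eval (conj_root r) x"
        "cubic_eval (conj_root (conj_root r)) x"] assms that
    by (auto simp: cubic_totpos_iff cubic_eval_mult cubic_eval_eq_0_iff)
qed

lemma cubic_totpos_small_trace:
  assumes "cubic_totpos m" "cubic_trace m \<le> 6"
  shows "m \<in> {1, Cubic 2 1 0, Cubic 1 2 1, Cubic 0 0 1, Cubic 3 (-1) (-1), Cubic 5 (-1) (-2),
    Cubic 0 (-1) 1, 2}"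
proof -
  obtain a b c where m: "m = Cubic a b c"
    by (cases m)
  define t where "t = cubic_trace m"
  have t: "t = 3 * a - b + 5 * c"
    by (simp add: t_def m cubic_trace_def)
  have pos: "t > 0" "cubic_sym2 m > 0" "cubic_norm m > 0" and "t \<le> 6"
    using cubic_totpos_imp[OF assms(1)] assms(2) by (simp_all add: t_def)
  have "t\<^sup>2 \<le> 6\<^sup>2"
    using pos(1) \<open>t \<le> 6\<close> by (intro power_mono) simp_all
  moreover have "7 * ((2 * b - c)\<^sup>2 + 3 * c\<^sup>2) = 4 * t\<^sup>2 - 12 * cubic_sym2 m"
    by (simp add: m t cubic_sym2_def algebra_simps power2_eq_square)
  ultimately have "(2 * b - c)\<^sup>2 + 3 * c\<^sup>2 \<le> 18"
    using pos(2) by simp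
  then have "c\<^sup>2 < 9" "(2 * b - c)\<^sup>2 < 25"
    using zero_le_power2[of c] zero_le_power2[of "2 * b - c"] by linarith+
  then have bc: "\<bar>c\<bar> < 3" "\<bar>2 * b - c\<bar> < 5"
    using abs_le_square_iff[of 3 c] abs_le_square_iff[of 5 "2 * b - c"] by auto
  then have "c \<in> {-2, -1, 0, 1, 2}" "b \<in> {-3, -2, -1, 0, 1, 2, 3}" "t \<in> {1, 2, 3, 4, 5, 6}"
    using pos(1) \<open>t \<le> 6\<close> by auto
  moreover have a: "a = (t + b - 5 * c) div 3" and "3 dvd t + b - 5 * c"
    by (simp_all add: t)
  ultimately show ?thesis
    using bc(2) pos(2,3) unfolding m a
    by (elim insertE emptyE) (simp_all add: cubic_sym2_def cubic_norm_def cubic_eq_iff)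
qed

lemma cubic_totpos_small_trace_cases:
  assumes "cubic_totpos m" "cubic_trace m \<le> 6"
  obtains "m = 2" | e where "e dvd 1" "m = e * e"
proof -
  define E where "E = {1, Cubic (-1) 1 1, Cubic 1 1 0, Cubic 0 1 0, Cubic (-2) 0 1,
    Cubic (-2) 1 1, Cubic (-1) 0 1}"
  have "(\<lambda>e. e * e) ` E = {1, Cubic 2 1 0, Cubic 1 2 1, Cubic 0 0 1, Cubic 3 (-1) (-1),
      Cubic 5 (-1) (-2), Cubic 0 (-1) 1}"
    by (simp add: E_def times_cubic_def one_cubic_def)
  then have "m = 2 \<or> m \<in> (\<lambda>e. e * e) ` E"
    using cubic_totpos_small_trace[OF assms] by auto
  moreover have "\<forall>e\<in>E. e dvd 1"
    by (simp add: E_def cubic_is_unit_iff cubic_norm_def)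
  ultimately show thesis
    using that by blast
qed

section \<open>Hurwitz quaternions over a commutative ring\<close>

text \<open>Coordinates with respect to \<open>1\<close>, \<open>(1+i+j+k)/2\<close>, \<open>i\<close>, \<open>(-1+i+j-k)/2\<close>; in this basis of the
  Hurwitz order the reduced norm is the quadratic form of the theorem.\<close>

datatype 'a hurwitz = Hurwitz (qa: 'a) (qb: 'a) (qc: 'a) (qd: 'a)

lemma hurwitz_eq_iff: "x = y \<longleftrightarrow> qa x = qa y \<and> qb x = qb y \<and> qc x = qc y \<and> qd x = qd y"
  by (cases x; cases y) simp

instantiation hurwitz :: (comm_ring_1) ring_1
begin

definition "0 = Hurwitz 0 0 0 0"
definition "1 = Hurwitz 1 0 0 0"
definition "x + y = Hurwitz (qa x + qa y) (qb x + qb y) (qc x + qc y) (qd x + qd y)"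
definition "x - y = Hurwitz (qa x - qa y) (qb x - qb y) (qc x - qc y) (qd x - qd y)"
definition "- x = Hurwitz (- qa x) (- qb x) (- qc x) (- qd x)"
definition "x * y = Hurwitz
  (qa x * qa y - qb x * qb y - qc x * qb y - qc x * qc y - qc x * qd y - qd x * qd y)
  (qa x * qb y + qb x * qa y + qb x * qb y + qc x * qd y - qd x * qb y - qd x * qc y)
  (qa x * qc y - qb x * qd y + qc x * qa y + qc x * qb y - qc x * qd y + qd x * qb y)
  (qa x * qd y + qb x * qc y + qb x * qd y - qc x * qb y + qd x * qa y - qd x * qd y)"

instance
  by standard
    (auto simp: zero_hurwitz_def one_hurwitz_def plus_hurwitz_def minus_hurwitz_def
      uminus_hurwitz_def times_hurwitz_def algebra_simps)

end

lemma hurwitz_sel [simp]: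
  "qa 0 = 0" "qb 0 = 0" "qc 0 = 0" "qd 0 = 0"
  "qa 1 = 1" "qb 1 = 0" "qc 1 = 0" "qd 1 = 0"
  "qa (x + y) = qa x + qa y" "qb (x + y) = qb x + qb y"
  "qc (x + y) = qc x + qc y" "qd (x + y) = qd x + qd y"
  "qa (x - y) = qa x - qa y" "qb (x - y) = qb x - qb y"
  "qc (x - y) = qc x - qc y" "qd (x - y) = qd x - qd y"
  "qa (- x) = - qa x" "qb (- x) = - qb x" "qc (- x) = - qc x" "qd (- x) = - qd x"
  by (simp_all add: zero_hurwitz_def one_hurwitz_def plus_hurwitz_def minus_hurwitz_def
      uminus_hurwitz_def)

lemma hurwitz_sel_times:
  "qa (x * y) = qa x * qa y - qb x * qb y - qc x * qb y - qc x * qc y - qc x * qd y - qd x * qd y"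
  "qb (x * y) = qa x * qb y + qb x * qa y + qb x * qb y + qc x * qd y - qd x * qb y - qd x * qc y"
  "qc (x * y) = qa x * qc y - qb x * qd y + qc x * qa y + qc x * qb y - qc x * qd y + qd x * qb y"
  "qd (x * y) = qa x * qd y + qb x * qc y + qb x * qd y - qc x * qb y + qd x * qa y - qd x * qd y"
  by (simp_all add: times_hurwitz_def)

definition of_scalar :: "'a::comm_ring_1 \<Rightarrow> 'a hurwitz" where
  "of_scalar c = Hurwitz c 0 0 0"

definition hconj :: "'a::comm_ring_1 hurwitz \<Rightarrow> 'a hurwitz" where
  "hconj x = Hurwitz (qa x + qb x - qd x) (- qb x) (- qc x) (- qd x)"

definition nrd :: "'a::comm_ring_1 hurwitz \<Rightarrow> 'a" where
  "nrd x = (qa x)\<^sup>2 + qa x * qb x + (qb x)\<^sup>2 + qb x * qc x - qa x * qd x + (qc x)\<^sup>2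
    + qc x * qd x + (qd x)\<^sup>2"

definition trd :: "'a::comm_ring_1 hurwitz \<Rightarrow> 'a" where
  "trd x = 2 * qa x + qb x - qd x"

lemma of_scalar_sel [simp]:
  "qa (of_scalar c) = c" "qb (of_scalar c) = 0" "qc (of_scalar c) = 0" "qd (of_scalar c) = 0"
  by (simp_all add: of_scalar_def)

lemma hconj_sel [simp]:
  "qa (hconj x) = qa x + qb x - qd x" "qb (hconj x) = - qb x"
  "qc (hconj x) = - qc x" "qd (hconj x) = - qd x"
  by (simp_all add: hconj_def)

lemma map_hurwitz_sel [simp]:
  "qa (map_hurwitz f x) = f (qa x)" "qb (map_hurwitz f x) = f (qb x)"
  "qc (map_hurwitz f x) = f (qc x)" "qd (map_hurwitz f x) = f (qd x)"
  by (cases x; simp)+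

lemma of_scalar_add: "of_scalar (a + b) = of_scalar a + of_scalar b"
  and of_scalar_diff: "of_scalar (a - b) = of_scalar a - of_scalar b"
  and of_scalar_mult: "of_scalar (a * b) = of_scalar a * of_scalar b"
  and of_scalar_1 [simp]: "of_scalar 1 = 1"
  by (simp_all add: hurwitz_eq_iff hurwitz_sel_times)

lemma of_scalar_eq_iff [simp]: "of_scalar a = of_scalar b \<longleftrightarrow> a = b"
  by (simp add: hurwitz_eq_iff)

lemma of_scalar_commute: "x * of_scalar a = of_scalar a * x"
  by (simp add: hurwitz_eq_iff hurwitz_sel_times algebra_simps)

lemma of_scalar_left_commute: "x * (of_scalar a * y) = of_scalar a * (x * y)"
  by (metis of_scalar_commute mult.assoc)

lemma of_scalar_mult_eq_0_iff:
  fixes a :: "'a::idom"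
  shows "of_scalar a * x = 0 \<longleftrightarrow> a = 0 \<or> x = 0"
  by (auto simp: hurwitz_eq_iff hurwitz_sel_times)

lemma of_scalar_mult_cancel:
  fixes a :: "'a::idom"
  assumes "of_scalar a * x = of_scalar a * y" "a \<noteq> 0"
  shows "x = y"
proof -
  have "of_scalar a * (x - y) = 0"
    using assms by (simp add: right_diff_distrib)
  then show ?thesis
    using assms by (simp add: of_scalar_mult_eq_0_iff)
qed

lemma hconj_add: "hconj (x + y) = hconj x + hconj y"
  by (simp add: hurwitz_eq_iff)

lemma hconj_diff: "hconj (x - y) = hconj x - hconj y"
  by (simp add: hurwitz_eq_iff)

lemma hconj_mult: "hconj (x * y) = hconj y * hconj x"
  by (simp add: hurwitz_eq_iff hurwitz_sel_times algebra_simps)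

lemma hconj_conj [simp]: "hconj (hconj x) = x"
  by (simp add: hurwitz_eq_iff)

lemma hconj_of_scalar [simp]: "hconj (of_scalar c) = of_scalar c"
  by (simp add: hurwitz_eq_iff)

lemma hconj_0 [simp]: "hconj 0 = 0" and hconj_1 [simp]: "hconj 1 = 1"
  by (simp_all add: hurwitz_eq_iff)

lemma mult_hconj: "x * hconj x = of_scalar (nrd x)"
  by (simp add: hurwitz_eq_iff hurwitz_sel_times nrd_def algebra_simps power2_eq_square)

lemma hconj_mult_self: "hconj x * x = of_scalar (nrd x)"
  by (simp add: hurwitz_eq_iff hurwitz_sel_times nrd_def algebra_simps power2_eq_square)

lemma nrd_conj [simp]: "nrd (hconj x) = nrd x"
  by (simp add: nrd_def algebra_simps power2_eq_square)

lemma nrd_of_scalar [simp]: "nrd (of_scalar c) = c\<^sup>2"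
  by (simp add: nrd_def)

lemma nrd_mult: "nrd (x * y) = nrd x * nrd y"
proof -
  have "of_scalar (nrd (x * y)) = (x * y) * hconj (x * y)"
    by (simp only: mult_hconj)
  also have "\<dots> = x * (y * hconj y) * hconj x"
    by (simp only: hconj_mult mult.assoc)
  also have "\<dots> = of_scalar (nrd y) * (x * hconj x)"
    by (simp only: mult_hconj[of y] of_scalar_commute[of x] mult.assoc)
  also have "\<dots> = of_scalar (nrd x * nrd y)"
    by (simp only: mult_hconj of_scalar_mult[symmetric] mult.commute[of "nrd y"])
  finally show ?thesis
    by simp
qed

lemma trd_eq: "of_scalar (trd x) = x + hconj x"
  by (simp add: hurwitz_eq_iff trd_def)

lemma trd_mult_commute: "trd (x * y) = trd (y * x)"
  by (simp add: trd_def hurwitz_sel_times algebra_simps)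

lemma nrd_four_squares:
  "4 * nrd x = (2 * qa x + qb x - qd x)\<^sup>2 + (qb x + 2 * qc x + qd x)\<^sup>2 + (qb x + qd x)\<^sup>2
    + (qb x - qd x)\<^sup>2"
  by (simp add: nrd_def algebra_simps power2_eq_square)

lemma nrd_nonneg: "nrd (x :: 'a::linordered_idom hurwitz) \<ge> 0"
proof -
  have "4 * nrd x \<ge> 0"
    unfolding nrd_four_squares by simp
  then show ?thesis
    by (simp add: zero_le_mult_iff)
qed

lemma nrd_eq_0D:
  assumes "nrd (x :: 'a::linordered_idom hurwitz) = 0"
  shows "x = 0"
proof -
  have "(2 * qa x + qb x - qd x)\<^sup>2 + (qb x + 2 * qc x + qd x)\<^sup>2 + (qb x + qd x)\<^sup>2
      + (qb x - qd x)\<^sup>2 = 0"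
    using nrd_four_squares[of x] assms by simp
  then have "2 * qa x + qb x - qd x = 0" "qb x + 2 * qc x + qd x = 0" "qb x + qd x = 0"
    "qb x - qd x = 0"
    by (simp_all add: add_nonneg_eq_0_iff)
  then show ?thesis
    by (simp add: hurwitz_eq_iff)
qed

lemma nrd_diff: "nrd (x - y) = nrd x + nrd y - trd (x * hconj y)"
  by (simp add: nrd_def trd_def hurwitz_sel_times algebra_simps power2_eq_square)

lemma trd_of_scalar_mult: "trd (of_scalar a * x) = a * trd x"
  by (simp add: trd_def hurwitz_sel_times algebra_simps)

lemma trd_conj [simp]: "trd (hconj x) = trd x"
  by (simp add: trd_def)

subsection \<open>Division with remainder\<close>

lemma int_nearest_even_and_odd_multiple:
  fixes x a :: int
  assumes "a > 0"
  obtains m m' where "(x - 2 * a * m)\<^sup>2 + (x - a * (2 * m' + 1))\<^sup>2 \<le> a\<^sup>2"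
proof -
  define k r where "k = x div a" and "r = x mod a"
  have "0 \<le> r * (a - r)"
    using assms by (simp add: r_def less_imp_le)
  then have le: "r\<^sup>2 + (r - a)\<^sup>2 \<le> a\<^sup>2"
    by (simp add: algebra_simps power2_eq_square)
  have x: "x = a * k + r"
    by (simp add: k_def r_def)
  show thesis
  proof (cases "even k")
    case True
    then obtain m where "k = 2 * m"
      by blast
    with le show thesis
      by (intro that[of m m]) (simp add: x algebra_simps)
  next
    case False
    then obtain m where "k = 2 * m + 1"
      by (blast elim: oddE)
    with le show thesis
      by (intro that[of "m + 1" m]) (simp add: x algebra_simps)
  qed
qed

text \<open>In the coordinates of \<open>nrd_four_squares\<close> the Hurwitz order consists of the integral vectors
  whose coordinates are all even or all odd. The squared distances to the best even and to the
  best odd candidate add up to at most \<open>4a\<^sup>2\<close>.\<close>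

lemma hurwitz_division_by_int:
  fixes x :: "int hurwitz"
  assumes "a > 0"
  obtains q where "2 * nrd (x - of_scalar a * q) \<le> a\<^sup>2"
proof -
  define X1 X2 X3 X4 where X: "X1 = 2 * qa x + qb x - qd x" "X2 = qb x + 2 * qc x + qd x"
    "X3 = qb x + qd x" "X4 = qb x - qd x"
  obtain m1 n1 m2 n2 m3 n3 m4 n4 where mn:
    "(X1 - 2 * a * m1)\<^sup>2 + (X1 - a * (2 * n1 + 1))\<^sup>2 \<le> a\<^sup>2"
    "(X2 - 2 * a * m2)\<^sup>2 + (X2 - a * (2 * n2 + 1))\<^sup>2 \<le> a\<^sup>2"
    "(X3 - 2 * a * m3)\<^sup>2 + (X3 - a * (2 * n3 + 1))\<^sup>2 \<le> a\<^sup>2"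
    "(X4 - 2 * a * m4)\<^sup>2 + (X4 - a * (2 * n4 + 1))\<^sup>2 \<le> a\<^sup>2"
    using int_nearest_even_and_odd_multiple[OF assms] by metis
  define q q' where "q = Hurwitz (m1 - m4) (m3 + m4) (m2 - m3) (m3 - m4)"
    and "q' = Hurwitz (n1 - n4) (n3 + n4 + 1) (n2 - n3) (n3 - n4)"
  have "4 * nrd (x - of_scalar a * q) = (X1 - 2 * a * m1)\<^sup>2 + (X2 - 2 * a * m2)\<^sup>2
      + (X3 - 2 * a * m3)\<^sup>2 + (X4 - 2 * a * m4)\<^sup>2"
    unfolding nrd_four_squares X by (simp add: q_def hurwitz_sel_times algebra_simps)
  moreover have "4 * nrd (x - of_scalar a * q') = (X1 - a * (2 * n1 + 1))\<^sup>2
      + (X2 - a * (2 * n2 + 1))\<^sup>2 + (X3 - a * (2 * n3 + 1))\<^sup>2 + (X4 - a * (2 * n4 + 1))\<^sup>2"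
    unfolding nrd_four_squares X by (simp add: q'_def hurwitz_sel_times algebra_simps)
  ultimately have "2 * nrd (x - of_scalar a * q) \<le> a\<^sup>2 \<or> 2 * nrd (x - of_scalar a * q') \<le> a\<^sup>2"
    using mn by linarith
  then show thesis
    using that by blast
qed

lemma hurwitz_division:
  fixes x b :: "int hurwitz"
  assumes "b \<noteq> 0"
  obtains q where "nrd (x - q * b) < nrd b"
proof -
  have pos: "nrd b > 0"
    using assms nrd_nonneg[of b] nrd_eq_0D[of b] by (auto simp: less_le)
  obtain q where q: "2 * nrd (x * hconj b - of_scalar (nrd b) * q) \<le> (nrd b)\<^sup>2"
    using hurwitz_division_by_int[OF pos] .
  have "x * hconj b - of_scalar (nrd b) * q = (x - q * b) * hconj b"
    by (simp add: left_diff_distrib mult.assoc mult_hconj of_scalar_commute)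
  then have "2 * nrd (x - q * b) * nrd b \<le> nrd b * nrd b"
    using q by (simp add: nrd_mult power2_eq_square)
  then have "2 * nrd (x - q * b) \<le> nrd b"
    using pos by simp
  then show thesis
    using pos nrd_nonneg[of "x - q * b"] by (intro that[of q]) linarith
qed

lemma hurwitz_left_ideal_principal:
  fixes I :: "int hurwitz set"
  assumes zero: "0 \<in> I" and diff: "\<And>x y. x \<in> I \<Longrightarrow> y \<in> I \<Longrightarrow> x - y \<in> I"
    and mult: "\<And>a x. x \<in> I \<Longrightarrow> a * x \<in> I"
  obtains g where "g \<in> I" "\<And>x. x \<in> I \<Longrightarrow> \<exists>q. x = q * g"
proof (cases "I = {0}")
  case True
  then show thesis
    using that[of 0] by simp
next
  case False
  then obtain y where "y \<in> I \<and> y \<noteq> 0"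
    using zero by blast
  then obtain g where g: "g \<in> I" "g \<noteq> 0"
    and least: "\<And>x. x \<in> I \<Longrightarrow> x \<noteq> 0 \<Longrightarrow> nat (nrd g) \<le> nat (nrd x)"
    using ex_has_least_nat[of "\<lambda>x. x \<in> I \<and> x \<noteq> 0" y "\<lambda>x. nat (nrd x)"] by blast
  have "\<exists>q. x = q * g" if "x \<in> I" for x
  proof -
    obtain q where "nrd (x - q * g) < nrd g"
      using hurwitz_division[OF g(2)] .
    then have "x - q * g = 0"
      using least[OF diff[OF that mult[OF g(1)]], of q] nrd_nonneg[of "x - q * g"] by linarith
    then show ?thesis
      by (metis eq_iff_diff_eq_0)
  qed
  with g(1) show thesis
    by (rule that)
qed

lemma hurwitz_left_bezout:
  fixes a b :: "int hurwitz"
  obtains u v h k where "a = h * (u * a + v * b)" "b = k * (u * a + v * b)"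
proof -
  define I where "I = {x. \<exists>u v. x = u * a + v * b}"
  have in_I: "u * a + v * b \<in> I" for u v
    by (auto simp: I_def)
  obtain g where g: "g \<in> I" "\<And>x. x \<in> I \<Longrightarrow> \<exists>q. x = q * g"
  proof (rule hurwitz_left_ideal_principal[of I])
    show "0 \<in> I"
      using in_I[of 0 0] by simp
  next
    fix x y assume "x \<in> I" "y \<in> I"
    then obtain u v u' v' where "x = u * a + v * b" "y = u' * a + v' * b"
      by (auto simp: I_def)
    then show "x - y \<in> I"
      using in_I[of "u - u'" "v - v'"] by (simp add: algebra_simps)
  next
    fix c x assume "x \<in> I"
    then obtain u v where "x = u * a + v * b"
      by (auto simp: I_def)
    then show "c * x \<in> I"
      using in_I[of "c * u" "c * v"] by (simp add: algebra_simps)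
  qed blast
  obtain u v where uv: "g = u * a + v * b"
    using g(1) by (auto simp: I_def)
  obtain h where "a = h * g"
    using g(2)[of a] in_I[of 1 0] by auto
  moreover obtain k where "b = k * g"
    using g(2)[of b] in_I[of 0 1] by auto
  ultimately show thesis
    unfolding uv by (rule that)
qed

subsection \<open>Positive integers are reduced norms\<close>

lemma QuadRes_mult_if_not_QuadRes:
  fixes p :: nat
  assumes "prime p" "2 < p" "\<not> QuadRes (int p) a" "\<not> QuadRes (int p) b"
  shows "QuadRes (int p) (a * b)"
proof (rule ccontr)
  assume ab: "\<not> QuadRes (int p) (a * b)"
  have legendre: "[-1 = x ^ ((p - 1) div 2)] (mod int p)" if "\<not> QuadRes (int p) x" for x
  proof -
    have "\<not> [x = 0] (mod int p)"
      using that unfolding QuadRes_def by (metis cong_sym power_zero_numeral)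
    then show ?thesis
      using euler_criterion[OF assms(1,2), of x] that by (simp add: Legendre_def)
  qed
  have "[-1 * -1 = a ^ ((p - 1) div 2) * b ^ ((p - 1) div 2)] (mod int p)"
    using assms(3,4) by (intro cong_mult legendre)
  then have "[1 = -1] (mod int p)"
    using legendre[OF ab] by (simp add: power_mult_distrib) (metis cong_sym cong_trans)
  then have "int p dvd 2"
    by (simp add: cong_iff_dvd_diff)
  then show False
    using \<open>2 < p\<close> zdvd_imp_le by fastforce
qed

lemma exists_QuadRes_not_QuadRes_Suc:
  assumes "0 < m" "\<not> QuadRes (int m) (- 1)"
  obtains a where "QuadRes (int m) a" "\<not> QuadRes (int m) (a + 1)"
proof -
  have "\<exists>a. QuadRes (int m) a \<and> \<not> QuadRes (int m) (a + 1)"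
  proof (rule ccontr)
    assume step: "\<nexists>a. QuadRes (int m) a \<and> \<not> QuadRes (int m) (a + 1)"
    have "QuadRes (int m) (int n)" for n
    proof (induction n)
      case 0
      show ?case
        by (auto simp: QuadRes_def intro: exI[of _ 0])
    next
      case (Suc n)
      with step show ?case
        by (metis add.commute of_nat_Suc)
    qed
    from this[of "m - 1"] have "QuadRes (int m) (int m - 1)"
      using assms(1) by (simp add: of_nat_diff)
    with assms(2) show False
      by (auto simp: QuadRes_def cong_iff_dvd_diff dest: dvd_add[OF _ dvd_refl])
  qed
  then show thesis
    using that by blast
qed

text \<open>If \<open>a\<close> is a quadratic residue and \<open>a + 1\<close> is not, then \<open>-1\<close> or \<open>-(a + 1)\<close> is one.\<close>

lemma prime_dvd_one_plus_two_squares: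
  fixes p :: nat
  assumes "prime p"
  obtains x y where "int p dvd 1 + x\<^sup>2 + y\<^sup>2"
proof (cases "QuadRes (int p) (- 1)")
  case True
  then obtain x where "int p dvd x\<^sup>2 - (- 1)"
    by (auto simp: QuadRes_def cong_iff_dvd_diff)
  then show thesis
    by (intro that[of x 0]) (simp add: algebra_simps)
next
  case False
  have "QuadRes 2 (- 1)"
    by (auto simp: QuadRes_def cong_iff_dvd_diff intro!: exI[of _ 1])
  then have "p \<noteq> 2"
    using False by auto
  then have "2 < p"
    using prime_ge_2_nat[OF assms] by simp
  obtain a where a: "QuadRes (int p) a" "\<not> QuadRes (int p) (a + 1)"
    using exists_QuadRes_not_QuadRes_Suc[of p] False \<open>2 < p\<close> by auto
  then have "QuadRes (int p) (- 1 * (a + 1))"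
    using False QuadRes_mult_if_not_QuadRes[OF assms \<open>2 < p\<close>] by blast
  then obtain x y where "int p dvd x\<^sup>2 - a" "int p dvd y\<^sup>2 - (- 1 * (a + 1))"
    using a(1) unfolding QuadRes_def cong_iff_dvd_diff by blast
  then have "int p dvd (x\<^sup>2 - a) + (y\<^sup>2 - (- 1 * (a + 1)))"
    by (rule dvd_add)
  then show thesis
    by (intro that[of x y]) (simp add: algebra_simps)
qed

lemma of_scalar_divides_if_unit_combination:
  fixes c :: "'a::comm_ring_1"
  assumes "nrd (u * of_scalar c + v * x) = 1" and "c dvd nrd x"
  shows "\<exists>z. x = of_scalar c * z"
proof -
  define g where "g = u * of_scalar c + v * x"
  obtain k where k: "nrd x = c * k"
    using assms(2) by blast
  have "hconj x = hconj g * (g * hconj x)"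
    using assms(1) by (simp add: hconj_mult_self g_def flip: mult.assoc)
  also have "g * hconj x = of_scalar c * (u * hconj x + v * of_scalar k)"
    by (simp add: g_def distrib_left distrib_right mult.assoc mult_hconj k of_scalar_mult
        of_scalar_commute[of u] of_scalar_left_commute[of v])
  finally have "hconj x = of_scalar c * (hconj g * (u * hconj x + v * of_scalar k))"
    by (simp only: of_scalar_left_commute)
  then have "x = of_scalar c * hconj (hconj g * (u * hconj x + v * of_scalar k))"
    by (metis hconj_conj hconj_mult hconj_of_scalar of_scalar_commute)
  then show ?thesis
    by blast
qed

text \<open>The left ideal generated by \<open>p\<close> and \<open>\<alpha>\<close> is neither \<open>O\<close> nor \<open>Op\<close>, so its generator has
  norm \<open>p\<close>.\<close>

lemma prime_is_nrd_if_dvd_nrd: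
  fixes p :: nat and \<alpha> :: "int hurwitz"
  assumes p: "prime p" and dvd: "int p dvd nrd \<alpha>"
    and indivisible: "\<And>z. \<alpha> \<noteq> of_scalar (int p) * z"
  shows "\<exists>g. nrd g = int p"
proof -
  obtain u v h k where gcd: "of_scalar (int p) = h * (u * of_scalar (int p) + v * \<alpha>)"
    "\<alpha> = k * (u * of_scalar (int p) + v * \<alpha>)"
    using hurwitz_left_bezout .
  define g where "g = u * of_scalar (int p) + v * \<alpha>"
  have norms: "nrd h * nrd g = (int p)\<^sup>2"
    using arg_cong[OF gcd(1), of nrd] by (simp add: nrd_mult g_def)
  have "nrd g \<noteq> 1"
    using of_scalar_divides_if_unit_combination dvd indivisible unfolding g_def by blast
  moreover have "nrd h \<noteq> 1"
  proof
    assume "nrd h = 1"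
    then have "g = hconj h * (h * g)"
      by (simp add: hconj_mult_self flip: mult.assoc)
    then have "\<alpha> = of_scalar (int p) * (k * hconj h)"
      by (metis gcd g_def of_scalar_commute mult.assoc)
    with indivisible show False
      by blast
  qed
  moreover have "int (nat (nrd g)) dvd int (p\<^sup>2)"
    using nrd_nonneg[of g] by (simp flip: norms)
  then obtain i where "i \<le> 2" "nat (nrd g) = p ^ i"
    unfolding int_dvd_int_iff divides_primepow_nat[OF p] by blast
  then have "i \<le> 2" "nrd g = int p ^ i"
    using nrd_nonneg[of g] by (simp_all flip: of_nat_power)
  ultimately have "nrd g = int p"
    using norms p by (cases "i = 0"; cases "i = 1"; cases "i = 2") (auto simp: prime_gt_0_nat)
  then show ?thesis
    by blast
qed

lemma prime_is_nrd:
  fixes p :: nat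
  assumes "prime p"
  shows "\<exists>x. nrd x = int p"
proof -
  obtain x y where "int p dvd 1 + x\<^sup>2 + y\<^sup>2"
    using prime_dvd_one_plus_two_squares[OF assms] .
  then have "int p dvd nrd (Hurwitz 1 y (x - y) y)"
    by (simp add: nrd_def power2_eq_square algebra_simps)
  moreover have "Hurwitz 1 y (x - y) y \<noteq> of_scalar (int p) * z" for z
  proof
    assume "Hurwitz 1 y (x - y) y = of_scalar (int p) * z"
    then have "1 = int p * qa z"
      by (simp add: hurwitz_eq_iff hurwitz_sel_times)
    then show False
      using assms by (metis dvd_triv_left not_prime_unit prime_nat_int_transfer)
  qed
  ultimately show ?thesis
    by (rule prime_is_nrd_if_dvd_nrd[OF assms])
qed

lemma pos_int_is_nrd:
  assumes "n > 0"
  shows "\<exists>x. nrd x = int n"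
  using assms
proof (induction n rule: prime_divisors_induct)
  case (unit n)
  then show ?case
    by (auto intro!: exI[of _ 1] simp: nrd_def)
next
  case (factor p n)
  then obtain x where "nrd x = int n"
    by auto
  moreover obtain y where "nrd y = int p"
    using prime_is_nrd[OF factor.hyps] by blast
  ultimately have "nrd (y * x) = int (p * n)"
    by (simp add: nrd_mult)
  then show ?case
    by blast
qed simp

section \<open>Reduction of Hermitian lattices of rank three\<close>

locale hermitian_lattice =
  fixes act :: "int hurwitz \<Rightarrow> 'v::ab_group_add \<Rightarrow> 'v"
    and h :: "'v \<Rightarrow> 'v \<Rightarrow> int hurwitz"
    and n :: "'v \<Rightarrow> int"
  assumes h_diff: "h (u - v) w = h u w - h v w"
    and h_act: "h (act q u) w = q * h u w"
    and h_conj: "hconj (h u v) = h v u"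
    and h_self: "h u u = of_scalar (n u)"
    and n_nonneg: "n u \<ge> 0"
    and h_null: "n u = 0 \<Longrightarrow> h u v = 0"
begin

definition gram2 :: "'v \<Rightarrow> 'v \<Rightarrow> int" where
  "gram2 u v = n u * n v - nrd (h u v)"

text \<open>The Moore determinant of the Gram matrix.\<close>

definition gram3 :: "'v \<Rightarrow> 'v \<Rightarrow> 'v \<Rightarrow> int" where
  "gram3 u v w = n u * n v * n w + trd (h u v * h v w * h w u)
     - n u * nrd (h v w) - n v * nrd (h u w) - n w * nrd (h u v)"

text \<open>\<open>n u\<close> times the Hermitian product of the components of \<open>w\<close> and \<open>v\<close> orthogonal to \<open>u\<close>.\<close>

definition orth_h :: "'v \<Rightarrow> 'v \<Rightarrow> 'v \<Rightarrow> int hurwitz" where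
  "orth_h u v w = of_scalar (n u) * h w v - h w u * h u v"

lemma h_diff_right: "h w (u - v) = h w u - h w v"
  by (metis h_conj h_diff hconj_diff)

lemma h_act_right: "h w (act q u) = h w u * hconj q"
  by (metis h_conj h_act hconj_mult)

lemma h_null_right: "n u = 0 \<Longrightarrow> h v u = 0"
  using h_null[of u v] h_conj[of u v] by simp

lemma nrd_h_commute: "nrd (h u v) = nrd (h v u)"
  by (metis h_conj nrd_conj)

lemma h_mult_h_commute: "h v u * h u v = of_scalar (nrd (h u v))"
  by (metis h_conj hconj_mult_self)

lemma n_act: "n (act q u) = nrd q * n u"
proof -
  have "of_scalar (n (act q u)) = q * (of_scalar (n u) * hconj q)"
    by (simp only: h_self[symmetric] h_act h_act_right mult.assoc)
  also have "\<dots> = of_scalar (nrd q * n u)"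
    by (simp only: of_scalar_left_commute mult_hconj of_scalar_mult[symmetric] mult.commute)
  finally show ?thesis
    by simp
qed

lemma n_diff: "n (u - v) = n u + n v - trd (h u v)"
proof -
  have "of_scalar (n (u - v)) = of_scalar (n u) + of_scalar (n v) - (h u v + hconj (h u v))"
    by (simp only: h_self[symmetric] h_diff h_diff_right h_conj) (simp add: algebra_simps)
  also have "\<dots> = of_scalar (n u + n v - trd (h u v))"
    by (simp only: trd_eq[symmetric] of_scalar_add[symmetric] of_scalar_diff[symmetric])
  finally show ?thesis
    by simp
qed

lemma n_diff_act: "n (v - act q u) = n v + nrd q * n u - trd (q * h u v)"
proof -
  have "trd (h v (act q u)) = trd (q * h u v)"
    by (metis h_act h_conj trd_conj)
  then show ?thesis
    by (simp add: n_diff n_act)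
qed

lemma h_diff_act: "h u (v - act q u) = h u v - of_scalar (n u) * hconj q"
  by (simp add: h_diff_right h_act_right h_self)

lemma gram2_diff_act: "gram2 u (v - act q u) = gram2 u v"
proof -
  have "nrd (h u v - of_scalar (n u) * hconj q) =
      nrd (h u v) + (n u)\<^sup>2 * nrd q - n u * trd (q * h u v)"
    by (simp add: nrd_diff nrd_mult hconj_mult of_scalar_left_commute of_scalar_commute[of q]
        trd_of_scalar_mult trd_mult_commute[of "h u v"] mult.assoc)
  then show ?thesis
    by (simp add: gram2_def n_diff_act h_diff_act algebra_simps power2_eq_square)
qed

text \<open>\<open>n u * gram2 u v\<close> is the norm of the multiple \<open>n u v - h(v, u) u\<close> of the component of \<open>v\<close>
  orthogonal to \<open>u\<close>.\<close>

lemma gram2_nonneg: "gram2 u v \<ge> 0"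
proof (cases "n u = 0")
  case True
  then show ?thesis
    by (simp add: gram2_def h_null nrd_def)
next
  case False
  define w where "w = act (of_scalar (n u)) v - act (h v u) u"
  have "h v u * h u (act (of_scalar (n u)) v) = of_scalar (nrd (h u v) * n u)"
    by (simp add: h_act_right h_mult_h_commute of_scalar_mult flip: mult.assoc)
  then have "n w = n u * gram2 u v"
    by (simp add: w_def n_diff_act n_act gram2_def nrd_h_commute[of v u] trd_def algebra_simps
        power2_eq_square)
  then show ?thesis
    using n_nonneg[of w] n_nonneg[of u] False by (simp add: zero_le_mult_iff)
qed

lemma trd_h_cycle_reverse: "trd (h u v * h v w * h w u) = trd (h u w * h w v * h v u)"
proof -
  have "trd (h u v * h v w * h w u) = trd (hconj (h u v * h v w * h w u))"
    by simp
  also have "\<dots> = trd (h u w * h w v * h v u)"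
    by (simp only: hconj_mult h_conj mult.assoc)
  finally show ?thesis .
qed

lemma gram3_rotate: "gram3 u v w = gram3 v w u"
  using trd_mult_commute[of "h u v" "h v w * h w u"]
  by (simp add: gram3_def mult.assoc nrd_h_commute[of w u] nrd_h_commute[of v u])

lemma gram3_swap23: "gram3 u v w = gram3 u w v"
  by (simp add: gram3_def trd_h_cycle_reverse[of u v w] nrd_h_commute[of v w])

lemma gram3_expand: "n u * gram3 u v w = gram2 u v * gram2 u w - nrd (orth_h u v w)"
proof -
  have "trd (h w v * (hconj (h u v) * hconj (h w u))) = trd (h u v * h v w * h w u)"
    using trd_mult_commute[of "h u w" "h w v * h v u"] trd_h_cycle_reverse[of u v w]
    by (simp add: h_conj mult.assoc)
  then have "nrd (orth_h u v w) = (n u)\<^sup>2 * nrd (h w v) + nrd (h w u) * nrd (h u v)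
      - n u * trd (h u v * h v w * h w u)"
    by (simp add: orth_h_def nrd_diff nrd_mult hconj_mult trd_of_scalar_mult mult.assoc)
  then show ?thesis
    by (simp add: gram3_def gram2_def nrd_h_commute[of w] algebra_simps power2_eq_square)
qed

lemma gram3_null: "n u = 0 \<Longrightarrow> gram3 u v w = 0"
  by (simp add: gram3_def h_null h_null_right nrd_def trd_def)

lemma orth_h_diff_act_middle: "orth_h u (v - act q u) w = orth_h u v w"
  by (simp add: orth_h_def h_self h_diff_right h_act_right right_diff_distrib
      of_scalar_left_commute)

lemma orth_h_diff_act_right: "orth_h u v (w - act q v) = orth_h u v w - of_scalar (gram2 u v) * q"
proof -
  have "orth_h u v (w - act q v) =
      orth_h u v w - (of_scalar (n u) * (q * of_scalar (n v)) - q * (h v u * h u v))"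
    by (simp add: orth_h_def h_diff h_act h_self algebra_simps)
  also have "of_scalar (n u) * (q * of_scalar (n v)) - q * (h v u * h u v) =
      of_scalar (gram2 u v) * q"
    by (simp add: h_mult_h_commute gram2_def of_scalar_diff of_scalar_mult of_scalar_commute[of q]
        left_diff_distrib mult.assoc)
  finally show ?thesis .
qed

lemma gram3_diff_act: "gram3 u (v - act q u) w = gram3 u v w"
proof (cases "n u = 0")
  case False
  moreover have "n u * gram3 u (v - act q u) w = n u * gram3 u v w"
    by (simp add: gram3_expand gram2_diff_act orth_h_diff_act_middle)
  ultimately show ?thesis
    by simp
qed (simp add: gram3_null)

lemma hermite_inequality_gram2:
  assumes "n u > 0" and minimal: "\<And>q. n u \<le> n (v - act q u)"
  shows "(n u)\<^sup>2 \<le> 2 * gram2 u v"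
proof -
  obtain q where "2 * nrd (h v u - of_scalar (n u) * q) \<le> (n u)\<^sup>2"
    using hurwitz_division_by_int[OF assms(1)] .
  moreover define v' where "v' = v - act q u"
  moreover have "h v' u = h v u - of_scalar (n u) * q"
    by (simp add: v'_def h_diff h_act h_self of_scalar_commute)
  ultimately have "2 * nrd (h u v') \<le> (n u)\<^sup>2"
    by (simp add: nrd_h_commute[of u])
  moreover have "n u * n u \<le> n u * n v'"
    using assms(1) minimal by (simp add: v'_def)
  moreover have "gram2 u v = n u * n v' - nrd (h u v')"
    by (simp add: v'_def gram2_diff_act flip: gram2_def)
  ultimately show ?thesis
    by (simp add: power2_eq_square)
qed

lemma hermite_inequality_gram3:
  assumes "gram2 u v > 0" and minimal: "\<And>q. gram2 u v \<le> gram2 u (w - act q v)"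
  shows "(gram2 u v)\<^sup>2 \<le> 2 * n u * gram3 u v w"
proof -
  obtain q where "2 * nrd (orth_h u v w - of_scalar (gram2 u v) * q) \<le> (gram2 u v)\<^sup>2"
    using hurwitz_division_by_int[OF assms(1)] .
  moreover define w' where "w' = w - act q v"
  ultimately have "2 * nrd (orth_h u v w') \<le> (gram2 u v)\<^sup>2"
    by (simp add: orth_h_diff_act_right)
  moreover have "gram2 u v * gram2 u v \<le> gram2 u v * gram2 u w'"
    using assms(1) minimal by (simp add: w'_def)
  moreover have "gram3 u v w = gram3 u v w'"
    using gram3_diff_act[of v w q u] by (simp add: w'_def gram3_rotate[of u v])
  ultimately show ?thesis
    using gram3_expand[of u v w'] by (simp add: power2_eq_square)
qed

text \<open>Minimise first the norm of \<open>u\<close> and then the determinant of \<open>u, v\<close>.\<close>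

theorem exists_hermite_reduced:
  assumes "gram3 u\<^sub>0 v\<^sub>0 w\<^sub>0 = d" and "d > 0"
  obtains u v where "n u > 0" "(n u)\<^sup>2 \<le> 2 * gram2 u v" "(gram2 u v)\<^sup>2 \<le> 2 * n u * d"
proof -
  obtain u where "\<exists>v w. gram3 u v w = d"
    and min_n: "\<And>u' v' w'. gram3 u' v' w' = d \<Longrightarrow> nat (n u) \<le> nat (n u')"
    using ex_has_least_nat[of "\<lambda>u. \<exists>v w. gram3 u v w = d" u\<^sub>0 "\<lambda>u. nat (n u)"] assms(1) by blast
  then obtain v where "\<exists>w. gram3 u v w = d"
    and min_gram2: "\<And>v' w'. gram3 u v' w' = d \<Longrightarrow> nat (gram2 u v) \<le> nat (gram2 u v')"
    using ex_has_least_nat[of "\<lambda>v. \<exists>w. gram3 u v w = d" _ "\<lambda>v. nat (gram2 u v)"] by metis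
  then obtain w where d: "gram3 u v w = d"
    by blast
  have pos: "n u > 0"
    using gram3_null[of u v w] n_nonneg[of u] d assms(2) by linarith
  have ineq2: "(n u)\<^sup>2 \<le> 2 * gram2 u v"
  proof (rule hermite_inequality_gram2[OF pos])
    fix q
    have "gram3 (v - act q u) w u = d"
      using d gram3_diff_act[of u v q w] by (simp add: gram3_rotate)
    then show "n u \<le> n (v - act q u)"
      using min_n n_nonneg by (metis nat_le_eq_zle nat_le_iff)
  qed
  moreover have "(gram2 u v)\<^sup>2 \<le> 2 * n u * d"
    unfolding d[symmetric]
  proof (rule hermite_inequality_gram3)
    show "gram2 u v > 0"
      using ineq2 pos by (smt (verit) zero_less_power)
    fix q
    have "gram3 u (w - act q v) v = d"
      using d gram3_diff_act[of v w q u] by (metis gram3_rotate gram3_swap23)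
    then show "gram2 u v \<le> gram2 u (w - act q v)"
      using min_gram2[of "w - act q v" v] gram2_nonneg[of u "w - act q v"] by linarith
  qed
  ultimately show thesis
    using pos that by blast
qed

end

section \<open>Reduced norms over the cubic ring\<close>

definition hurwitz_of_int :: "int hurwitz \<Rightarrow> cubic hurwitz" where
  "hurwitz_of_int = map_hurwitz of_int"

lemma hurwitz_of_int_sel [simp]:
  "qa (hurwitz_of_int x) = of_int (qa x)" "qb (hurwitz_of_int x) = of_int (qb x)"
  "qc (hurwitz_of_int x) = of_int (qc x)" "qd (hurwitz_of_int x) = of_int (qd x)"
  by (simp_all add: hurwitz_of_int_def)

lemma hurwitz_of_int_hom:
  "hurwitz_of_int (x - y) = hurwitz_of_int x - hurwitz_of_int y"
  "hurwitz_of_int (x * y) = hurwitz_of_int x * hurwitz_of_int y"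
  "hurwitz_of_int 0 = 0" "hurwitz_of_int 1 = 1"
  by (simp_all add: hurwitz_eq_iff hurwitz_sel_times)

lemma nrd_hurwitz_of_int: "nrd (hurwitz_of_int x) = of_int (nrd x)"
  by (simp add: nrd_def)

definition hurwitz_trace :: "cubic hurwitz \<Rightarrow> int hurwitz" where
  "hurwitz_trace = map_hurwitz cubic_trace"

lemma hurwitz_trace_sel [simp]:
  "qa (hurwitz_trace x) = cubic_trace (qa x)" "qb (hurwitz_trace x) = cubic_trace (qb x)"
  "qc (hurwitz_trace x) = cubic_trace (qc x)" "qd (hurwitz_trace x) = cubic_trace (qd x)"
  by (simp_all add: hurwitz_trace_def)

lemma hurwitz_trace_0 [simp]: "hurwitz_trace 0 = 0"
  by (simp add: hurwitz_eq_iff cubic_trace_linear)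

lemma hurwitz_trace_diff: "hurwitz_trace (x - y) = hurwitz_trace x - hurwitz_trace y"
  by (simp add: hurwitz_eq_iff cubic_trace_linear)

lemma hurwitz_trace_conj: "hurwitz_trace (hconj x) = hconj (hurwitz_trace x)"
  by (simp add: hurwitz_eq_iff cubic_trace_linear)

lemma hurwitz_trace_of_scalar: "hurwitz_trace (of_scalar x) = of_scalar (cubic_trace x)"
  by (simp add: hurwitz_eq_iff cubic_trace_linear)

lemma hurwitz_trace_of_int_mult: "hurwitz_trace (hurwitz_of_int q * x) = q * hurwitz_trace x"
  by (simp add: hurwitz_eq_iff hurwitz_sel_times cubic_trace_linear cubic_trace_of_int_mult)

text \<open>The prime 7 is totally ramified with residue field of order 7, so the trace is congruent to
  three times the reduction.\<close>

lemma cubic_trace_mult_mod_7: "7 dvd cubic_trace x * cubic_trace y - 3 * cubic_trace (x * y)"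
proof
  show "cubic_trace x * cubic_trace y - 3 * cubic_trace (x * y) =
    7 * (cf1 x * cf2 y + cf2 x * cf1 y - 2 * cf1 x * cf1 y - 2 * cf2 x * cf2 y)"
    by (simp add: cubic_trace_def cubic_sel_times algebra_simps)
qed

lemma nrd_hurwitz_trace_mod_7: "7 dvd nrd (hurwitz_trace x) - 3 * cubic_trace (nrd x)"
proof -
  define d where "d y z = cubic_trace y * cubic_trace z - 3 * cubic_trace (y * z)" for y z
  have "nrd (hurwitz_trace x) - 3 * cubic_trace (nrd x) =
    d (qa x) (qa x) + d (qa x) (qb x) + d (qb x) (qb x) + d (qb x) (qc x) - d (qa x) (qd x)
    + d (qc x) (qc x) + d (qc x) (qd x) + d (qd x) (qd x)"
    by (simp add: nrd_def d_def power2_eq_square cubic_trace_linear)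
  also have "7 dvd \<dots>"
    by (intro dvd_add dvd_diff) (simp_all add: d_def cubic_trace_mult_mod_7)
  finally show ?thesis .
qed

lemma cubic_eval_nrd:
  assumes "cubic_poly r = 0"
  shows "cubic_eval r (nrd x) = nrd (map_hurwitz (cubic_eval r) x)"
  by (simp add: nrd_def power2_eq_square cubic_eval_add cubic_eval_diff cubic_eval_mult[OF assms])

lemma nrd_cubic_eq_0D:
  fixes x :: "cubic hurwitz"
  assumes "nrd x = 0"
  shows "x = 0"
proof -
  obtain r :: real where r: "cubic_poly r = 0"
    using cubic_poly_real_root_ge_1_exists by blast
  have "map_hurwitz (cubic_eval r) x = 0"
    using cubic_eval_nrd[OF r, of x] assms by (intro nrd_eq_0D) simp
  then show ?thesis
    by (simp add: hurwitz_eq_iff cubic_eval_eq_0_iff[OF r])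
qed

lemma cubic_trace_gram_det:
  fixes m :: cubic and k :: int
  defines "x \<equiv> cubic_rho - of_int k" and "y \<equiv> (cubic_rho - of_int k) * (cubic_rho + of_int k)"
  shows "cubic_trace m * cubic_trace (m * x * x) * cubic_trace (m * y * y)
    + 2 * cubic_trace (m * x) * cubic_trace (m * x * y) * cubic_trace (m * y)
    - cubic_trace m * (cubic_trace (m * x * y))\<^sup>2
    - cubic_trace (m * x * x) * (cubic_trace (m * y))\<^sup>2
    - cubic_trace (m * y * y) * (cubic_trace (m * x))\<^sup>2 = 49 * cubic_norm m"
proof -
  define t0 t1 t2 t3 t4 where t: "t0 = 3 * cf0 m - cf1 m + 5 * cf2 m"
    "t1 = 5 * cf1 m - cf0 m - 4 * cf2 m" "t2 = 5 * cf0 m - 4 * cf1 m + 13 * cf2 m"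
    "t3 = 13 * cf1 m - 4 * cf0 m - 16 * cf2 m" "t4 = 13 * cf0 m - 16 * cf1 m + 38 * cf2 m"
  have traces: "cubic_trace m = t0" "cubic_trace (m * x) = t1 - k * t0"
    "cubic_trace (m * x * x) = t2 - 2 * k * t1 + k\<^sup>2 * t0"
    "cubic_trace (m * y) = t2 - k\<^sup>2 * t0"
    "cubic_trace (m * x * y) = t3 - k * t2 - k\<^sup>2 * t1 + k\<^sup>2 * k * t0"
    "cubic_trace (m * y * y) = t4 - 2 * k\<^sup>2 * t2 + k\<^sup>2 * k\<^sup>2 * t0"
    by (simp_all add: x_def y_def t cubic_trace_def cubic_sel_times algebra_simps power2_eq_square)
  have "t0 * t2 * t4 + 2 * t1 * t2 * t3 - t0 * t3\<^sup>2 - t2 * t2\<^sup>2 - t4 * t1\<^sup>2 = 49 * cubic_norm m"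
    unfolding t cubic_norm_def Let_def
    by (simp add: algebra_simps power2_eq_square power3_eq_cube)
  then show ?thesis
    unfolding traces by (simp add: algebra_simps power2_eq_square)
qed

subsection \<open>The Hermitian lattice of a divisor of \<open>\<rho> - k\<close>\<close>

text \<open>The pair \<open>(a, w)\<close> represents the element \<open>a\<beta> + \<lambda>w\<close>, and \<open>form u v\<close> is the product \<open>u v\<^sup>*\<close> of
  two such elements divided by \<open>\<lambda>\<close>.\<close>

locale divisor_lattice =
  fixes l f :: cubic and k :: int and beta :: "int hurwitz"
  assumes totpos: "cubic_totpos l"
    and divisor: "l * f = cubic_rho - of_int k"
    and nrd_beta: "nrd beta = cubic_norm l"
begin

definition elt :: "int hurwitz \<times> cubic hurwitz \<Rightarrow> cubic hurwitz" where
  "elt u = hurwitz_of_int (fst u) * hurwitz_of_int beta + of_scalar l * snd u"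

definition form :: "int hurwitz \<times> cubic hurwitz \<Rightarrow> int hurwitz \<times> cubic hurwitz \<Rightarrow> cubic hurwitz" where
  "form u v = of_scalar (cubic_adj l) * (hurwitz_of_int (fst u) * hconj (hurwitz_of_int (fst v)))
     + hurwitz_of_int (fst u) * hurwitz_of_int beta * hconj (snd v)
     + snd u * hconj (hurwitz_of_int beta) * hconj (hurwitz_of_int (fst v))
     + of_scalar l * (snd u * hconj (snd v))"

definition act :: "int hurwitz \<Rightarrow> int hurwitz \<times> cubic hurwitz \<Rightarrow> int hurwitz \<times> cubic hurwitz" where
  "act q u = (q * fst u, hurwitz_of_int q * snd u)"

definition herm :: "int hurwitz \<times> cubic hurwitz \<Rightarrow> int hurwitz \<times> cubic hurwitz \<Rightarrow> int hurwitz" where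
  "herm u v = hurwitz_trace (form u v)"

definition quot :: "int hurwitz \<times> cubic hurwitz \<Rightarrow> cubic" where
  "quot u = qa (form u u)"

lemma l_nonzero: "l \<noteq> 0"
  using cubic_totpos_imp(3)[OF totpos] by auto

lemma form_eq: "of_scalar l * form u v = elt u * hconj (elt v)"
proof -
  define a b c w x where defs: "a = hurwitz_of_int (fst u)" "b = hurwitz_of_int (fst v)"
    "c = hurwitz_of_int beta" "w = snd u" "x = snd v"
  have "c * hconj c = of_scalar l * of_scalar (cubic_adj l)"
    by (simp add: mult_hconj defs nrd_hurwitz_of_int nrd_beta cubic_norm_adj of_scalar_mult)
  then have "c * (hconj c * hconj b) = of_scalar l * (of_scalar (cubic_adj l) * hconj b)"
    by (metis mult.assoc)
  then have "elt u * hconj (elt v) = a * (of_scalar l * (of_scalar (cubic_adj l) * hconj b))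
      + a * (c * (of_scalar l * hconj x)) + of_scalar l * (w * (hconj c * hconj b))
      + of_scalar l * (w * (of_scalar l * hconj x))"
    by (simp add: elt_def hconj_add hconj_mult of_scalar_commute distrib_left distrib_right
        mult.assoc flip: defs)
  also have "\<dots> = of_scalar l * form u v"
    by (simp add: form_def distrib_left mult.assoc of_scalar_left_commute[of a]
        of_scalar_left_commute[of c] of_scalar_left_commute[of w] flip: defs)
  finally show ?thesis ..
qed

lemma form_diff: "form (u - v) w = form u w - form v w"
  by (simp add: form_def hurwitz_of_int_hom algebra_simps)

lemma form_act: "form (act q u) w = hurwitz_of_int q * form u w"
  by (simp only: form_def act_def fst_conv snd_conv hurwitz_of_int_hom distrib_left mult.assoc
      of_scalar_left_commute[of "hurwitz_of_int q"])

lemma form_conj: "hconj (form u v) = form v u"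
proof -
  have "of_scalar l * hconj (form u v) = hconj (of_scalar l * form u v)"
    by (simp only: hconj_mult hconj_of_scalar of_scalar_commute)
  also have "\<dots> = of_scalar l * form v u"
    by (simp only: form_eq hconj_mult hconj_conj)
  finally show ?thesis
    using l_nonzero by (rule of_scalar_mult_cancel)
qed

lemma form_self: "form u u = of_scalar (quot u)"
  and nrd_elt: "nrd (elt u) = l * quot u"
proof -
  have "of_scalar l * form u u = of_scalar (nrd (elt u))"
    by (simp add: form_eq mult_hconj)
  then show "form u u = of_scalar (quot u)" and "nrd (elt u) = l * quot u"
    using l_nonzero by (auto simp: hurwitz_eq_iff hurwitz_sel_times quot_def)
qed

lemma nrd_form: "nrd (form u v) = quot u * quot v"
proof -
  have "l\<^sup>2 * nrd (form u v) = nrd (of_scalar l * form u v)"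
    by (simp add: nrd_mult)
  also have "\<dots> = l\<^sup>2 * (quot u * quot v)"
    by (simp add: form_eq nrd_mult nrd_elt power2_eq_square)
  finally show ?thesis
    using l_nonzero by simp
qed

lemma quot_totpos:
  assumes "quot u \<noteq> 0"
  shows "cubic_totpos (quot u)"
  unfolding cubic_totpos_def
proof (intro allI impI)
  fix r :: real
  assume r: "cubic_poly r = 0"
  have "cubic_eval r l * cubic_eval r (quot u) = nrd (map_hurwitz (cubic_eval r) (elt u))"
    using nrd_elt[of u] cubic_eval_mult[OF r] cubic_eval_nrd[OF r] by metis
  then have "cubic_eval r l * cubic_eval r (quot u) \<ge> 0"
    by (simp add: nrd_nonneg)
  moreover have "cubic_eval r l > 0"
    using totpos r by (simp add: cubic_totpos_def)
  moreover have "cubic_eval r (quot u) \<noteq> 0"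
    using assms cubic_eval_eq_0_iff[OF r] by simp
  ultimately show "cubic_eval r (quot u) > 0"
    by (simp add: zero_le_mult_iff)
qed

lemma trace_quot_pos_iff: "cubic_trace (quot u) > 0 \<longleftrightarrow> quot u \<noteq> 0"
  using quot_totpos[of u] cubic_totpos_imp(1)[of "quot u"] by (auto simp: cubic_trace_linear)

sublocale hermitian_lattice act herm "\<lambda>u. cubic_trace (quot u)"
proof
  fix u v w q
  show "herm (u - v) w = herm u w - herm v w"
    by (simp add: herm_def form_diff hurwitz_trace_diff)
  show "herm (act q u) w = q * herm u w"
    by (simp add: herm_def form_act hurwitz_trace_of_int_mult)
  show "hconj (herm u v) = herm v u"
    by (simp add: herm_def form_conj flip: hurwitz_trace_conj)
  show "herm u u = of_scalar (cubic_trace (quot u))"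
    by (simp add: herm_def form_self hurwitz_trace_of_scalar)
  show "cubic_trace (quot u) \<ge> 0"
    using trace_quot_pos_iff[of u] by (cases "quot u = 0") (simp_all add: cubic_trace_linear)
  show "herm u v = 0" if "cubic_trace (quot u) = 0"
  proof -
    have "quot u = 0"
      using that trace_quot_pos_iff[of u] by auto
    then have "form u v = 0"
      by (intro nrd_cubic_eq_0D) (simp add: nrd_form)
    then show ?thesis
      by (simp add: herm_def)
  qed
qed

lemma seven_dvd_gram2: "7 dvd gram2 u v"
proof -
  have "7 dvd (cubic_trace (quot u) * cubic_trace (quot v) - 3 * cubic_trace (quot u * quot v))
      - (nrd (herm u v) - 3 * cubic_trace (quot u * quot v))"
    using nrd_hurwitz_trace_mod_7[of "form u v"]
    by (intro dvd_diff[OF cubic_trace_mult_mod_7]) (simp add: herm_def nrd_form)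
  then show ?thesis
    by (simp add: gram2_def)
qed

lemma gram3_scalars:
  "gram3 (1, 0) (0, of_scalar x) (0, of_scalar y) =
    cubic_trace (cubic_adj l) * cubic_trace (l * x * x) * cubic_trace (l * y * y)
    + 2 * cubic_trace x * cubic_trace (l * x * y) * cubic_trace y * cubic_norm l
    - cubic_trace (cubic_adj l) * (cubic_trace (l * x * y))\<^sup>2
    - cubic_trace (l * x * x) * (cubic_trace y)\<^sup>2 * cubic_norm l
    - cubic_trace (l * y * y) * (cubic_trace x)\<^sup>2 * cubic_norm l"
proof -
  have left: "herm (1, 0) (0, of_scalar z) = beta * of_scalar (cubic_trace z)" for z
    by (simp add: herm_def form_def hurwitz_of_int_hom hurwitz_trace_of_int_mult
        hurwitz_trace_of_scalar)
  have right: "herm (0, of_scalar z) (1, 0) = of_scalar (cubic_trace z) * hconj beta" for z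
    using h_conj[of "(1, 0)" "(0, of_scalar z)"] by (simp add: left hconj_mult)
  have middle: "herm (0, of_scalar z) (0, of_scalar z') = of_scalar (cubic_trace (l * z * z'))"
    for z z'
    by (simp add: herm_def form_def hurwitz_of_int_hom hurwitz_trace_of_scalar mult.assoc
        flip: of_scalar_mult)
  have quot: "quot (1, 0) = cubic_adj l" "quot (0, of_scalar z) = l * z * z" for z
    by (simp_all add: quot_def form_def hurwitz_of_int_hom hurwitz_sel_times mult.assoc)
  have "trd (beta * of_scalar b * of_scalar c * (of_scalar d * hconj beta)) =
    2 * b * c * d * cubic_norm l" for b c d
  proof -
    have "beta * of_scalar b * of_scalar c * (of_scalar d * hconj beta) =
        of_scalar b * (of_scalar c * (of_scalar d * (beta * hconj beta)))"
      by (simp only: of_scalar_commute[of beta] of_scalar_left_commute[of beta] mult.assoc)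
    also have "\<dots> = of_scalar (b * (c * (d * cubic_norm l)))"
      by (simp only: mult_hconj nrd_beta of_scalar_mult)
    finally show ?thesis
      by (simp add: trd_def)
  qed
  then show ?thesis
    by (simp add: gram3_def left right middle quot nrd_mult nrd_beta)
qed

lemma gram3_basis: "gram3 (1, 0) (0, of_scalar f) (0, of_scalar (f * (cubic_rho + of_int k))) = 49"
proof -
  define N m where "N = cubic_norm l" and "m = cubic_adj l"
  define g where "g = f * (cubic_rho + of_int k)"
  define x y where "x = cubic_rho - of_int k"
    and "y = (cubic_rho - of_int k) * (cubic_rho + of_int k)"
  have N: "of_int N = m * l"
    by (simp add: N_def m_def cubic_norm_adj mult.commute)
  have lf: "x = l * f" and lg: "y = l * g"
    by (simp_all add: x_def y_def g_def divisor mult.assoc flip: divisor)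
  have traces: "N * cubic_trace f = cubic_trace (m * x)" "N * cubic_trace g = cubic_trace (m * y)"
    "N * cubic_trace (l * f * f) = cubic_trace (m * x * x)"
    "N * cubic_trace (l * f * g) = cubic_trace (m * x * y)"
    "N * cubic_trace (l * g * g) = cubic_trace (m * y * y)"
    by (simp_all only: N lf lg mult_ac flip: cubic_trace_of_int_mult)
  have "N\<^sup>2 * gram3 (1, 0) (0, of_scalar f) (0, of_scalar g) =
      cubic_trace m * (N * cubic_trace (l * f * f)) * (N * cubic_trace (l * g * g))
      + 2 * (N * cubic_trace f) * (N * cubic_trace (l * f * g)) * (N * cubic_trace g)
      - cubic_trace m * (N * cubic_trace (l * f * g))\<^sup>2
      - (N * cubic_trace (l * f * f)) * (N * cubic_trace g)\<^sup>2
      - (N * cubic_trace (l * g * g)) * (N * cubic_trace f)\<^sup>2"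
    unfolding gram3_scalars by (simp add: N_def m_def algebra_simps power2_eq_square)
  also have "\<dots> = 49 * cubic_norm m"
    unfolding traces x_def y_def by (rule cubic_trace_gram_det)
  also have "cubic_norm m = N\<^sup>2"
    by (simp add: m_def N_def cubic_norm_adj_eq)
  finally show ?thesis
    using l_nonzero by (simp add: N_def g_def)
qed

text \<open>Hermite's inequalities leave \<open>7\<close> as the only value larger than \<open>6\<close>; it would force the
  determinant \<open>gram2 u v\<close> to be \<open>25\<close> or \<open>26\<close>.\<close>

theorem exists_small_quotient:
  obtains x m where "nrd x = l * m" "cubic_totpos m" "cubic_trace m \<le> 6"
proof -
  obtain u v where pos: "cubic_trace (quot u) > 0"
    and ineq: "(cubic_trace (quot u))\<^sup>2 \<le> 2 * gram2 u v"
      "(gram2 u v)\<^sup>2 \<le> 2 * cubic_trace (quot u) * 49"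
    by (rule exists_hermite_reduced[OF gram3_basis]) simp
  define a g where "a = cubic_trace (quot u)" and "g = gram2 u v"
  have "a * a ^ 3 = (a\<^sup>2)\<^sup>2"
    by (simp add: power2_eq_square power3_eq_cube)
  also have "\<dots> \<le> (2 * g)\<^sup>2"
    using ineq(1) by (intro power_mono) (simp_all add: a_def g_def)
  also have "\<dots> \<le> a * 392"
    using ineq(2) by (simp add: a_def g_def power2_eq_square)
  finally have "a ^ 3 \<le> 392"
    using pos by (simp add: a_def)
  then have "a < 8"
    using power_mono[of 8 a 3] by (cases "a < 8") simp_all
  moreover have "a \<noteq> 7"
  proof
    assume "a = 7"
    then have "25 \<le> g" "g\<^sup>2 < 27\<^sup>2"
      using ineq by (simp_all add: a_def g_def)
    then have "g = 25 \<or> g = 26"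
      using power_less_imp_less_base[of g 2 27] by auto
    then show False
      using seven_dvd_gram2[of u v] by (auto simp: g_def)
  qed
  ultimately have "a \<le> 6"
    by simp
  moreover have "cubic_totpos (quot u)"
    using pos quot_totpos trace_quot_pos_iff by blast
  ultimately show thesis
    using that[OF nrd_elt] by (simp add: a_def)
qed

end

subsection \<open>Totally positive divisors of \<open>\<rho> - k\<close>\<close>

text \<open>The residue field of 2 has order 8 and hence contains no primitive cube root of unity.\<close>

lemma two_dvd_cubic_cube_root_form:
  assumes "(2 :: cubic) dvd s * s + s * t + t * t"
  shows "2 dvd s" "2 dvd t"
proof -
  have "2 dvd s \<and> 2 dvd t"
    using assms unfolding two_dvd_cubic_iff
    by (cases "even (cf0 s)"; cases "even (cf1 s)"; cases "even (cf2 s)";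
        cases "even (cf0 t)"; cases "even (cf1 t)"; cases "even (cf2 t)")
      (simp_all add: cubic_sel_times)
  then show "2 dvd s" "2 dvd t"
    by auto
qed

text \<open>An element of norm divisible by 2 is divisible by \<open>1 + i\<close>.\<close>

lemma nrd_divide_2:
  fixes x :: "cubic hurwitz"
  assumes "nrd x = l * 2"
  shows "\<exists>y :: cubic hurwitz. nrd y = l"
proof -
  define s t where "s = qa x + qc x" and "t = qb x + qd x"
  have "s * s + s * t + t * t = 2 * (l + qa x * qc x + qa x * qd x + qb x * qd x)"
    using assms by (simp add: nrd_def s_def t_def algebra_simps power2_eq_square)
  then have "2 dvd s * s + s * t + t * t"
    by simp
  then obtain s' t' where "s = 2 * s'" "t = 2 * t'"
    using two_dvd_cubic_cube_root_form by (metis dvdE)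
  then have ab: "qa x = 2 * s' - qc x" "qb x = 2 * t' - qd x"
    by (simp_all add: s_def t_def algebra_simps)
  define y where "y = Hurwitz (s' + t') (t' - qd x) (qc x - s' - t' + qd x) t'"
  have "of_scalar 2 * y = Hurwitz 1 0 (-1) 0 * x"
    by (simp add: hurwitz_eq_iff hurwitz_sel_times y_def ab algebra_simps)
  then have "nrd (of_scalar 2 * y) = nrd (Hurwitz 1 0 (-1) 0) * nrd x"
    by (simp only: nrd_mult)
  moreover have "nrd (Hurwitz 1 0 (-1) 0) = (2 :: cubic)"
    by (simp add: nrd_def)
  ultimately have "4 * nrd y = 4 * l"
    by (simp add: nrd_mult assms)
  then show ?thesis
    by auto
qed

lemma nrd_divide_unit_square:
  fixes x :: "'a::comm_ring_1 hurwitz"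
  assumes "nrd x = l * (e * e)" "e dvd 1"
  shows "\<exists>y :: 'a hurwitz. nrd y = l"
proof -
  obtain e' where e': "e * e' = 1"
    using assms(2) by (metis dvdE)
  have "nrd (of_scalar e' * x) = l * ((e * e') * (e * e'))"
    by (simp only: nrd_mult nrd_of_scalar assms(1) power2_eq_square mult_ac)
  then show ?thesis
    using e' by auto
qed

lemma nrd_divisor:
  assumes "cubic_totpos l" "l dvd cubic_rho - of_int k"
  shows "\<exists>x. nrd x = l"
proof -
  obtain f where f: "l * f = cubic_rho - of_int k"
    using assms(2) by (metis dvdE)
  obtain b where b: "nrd b = cubic_norm l"
    using pos_int_is_nrd[of "nat (cubic_norm l)"] cubic_totpos_imp(3)[OF assms(1)] by auto
  interpret divisor_lattice l f k b
    by unfold_locales (use assms f b in auto)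
  obtain x m where x: "nrd x = l * m" and m: "cubic_totpos m" "cubic_trace m \<le> 6"
    using exists_small_quotient .
  show ?thesis
    using m
  proof (cases rule: cubic_totpos_small_trace_cases)
    case 1
    then show ?thesis
      using nrd_divide_2 x by blast
  next
    case (2 e)
    then show ?thesis
      using nrd_divide_unit_square x by blast
  qed
qed

section \<open>Factorisation\<close>

lemma prime_dvd_norm_constant:
  fixes p a b c :: int
  assumes p: "prime p" and dvd: "p dvd cubic_norm (Cubic a b c)" "p dvd b" "p dvd c"
  shows "of_int p dvd Cubic a b c"
proof -
  have "of_int p dvd Cubic a b c - of_int a"
    using dvd by (simp add: of_int_dvd_cubic_iff)
  then have "p dvd cubic_norm (Cubic a b c) - a ^ 3"
    using cubic_norm_cong[of p "Cubic a b c" "of_int a"] by simp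
  then have "p dvd a ^ 3"
    using dvd_diff[OF dvd(1), of "cubic_norm (Cubic a b c) - a ^ 3"] by simp
  then have "p dvd a"
    using p prime_dvd_power by blast
  with dvd show ?thesis
    by (simp add: of_int_dvd_cubic_iff)
qed

lemma prime_dvd_norm_linear:
  fixes p g e :: int
  assumes p: "prime p" and no_root: "\<And>r. \<not> p dvd cubic_poly r"
    and dvd: "p dvd cubic_norm (Cubic g e 0)"
  shows "of_int p dvd Cubic g e 0"
proof -
  have "p dvd e"
  proof (rule ccontr)
    assume "\<not> p dvd e"
    then have "coprime e p"
      using p prime_imp_coprime coprime_commute by blast
    then obtain d where d: "[e * d = 1] (mod p)"
      using cong_solve_coprime_int by blast
    have norm: "cubic_norm (Cubic a b 0) = a ^ 3 - a\<^sup>2 * b - 2 * a * b\<^sup>2 + b ^ 3" for a b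
      by (simp add: cubic_norm_def)
    have "d ^ 3 * cubic_norm (Cubic g e 0) = cubic_norm (Cubic (g * d) (e * d) 0)"
      by (simp add: norm algebra_simps power2_eq_square power3_eq_cube)
    also have "[\<dots> = cubic_norm (Cubic (g * d) 1 0)] (mod p)"
      unfolding norm by (intro cong_add cong_diff cong_mult cong_pow cong_refl d)
    also have "cubic_norm (Cubic (g * d) 1 0) = - cubic_poly (- (g * d))"
      by (simp add: norm cubic_poly_def)
    finally have cong: "[d ^ 3 * cubic_norm (Cubic g e 0) = - cubic_poly (- (g * d))] (mod p)" .
    have "p dvd cubic_poly (- (g * d))"
      using dvd cong_dvd_iff[OF cong] by simp
    with no_root show False
      by blast
  qed
  then show ?thesis
    using prime_dvd_norm_constant[OF p dvd] by simp
qed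

text \<open>Modulo the minimal polynomial of \<open>\<rho>\<close>, the product of \<open>x = a + b\<rho> + c\<rho>\<^sup>2\<close> with \<open>c - b + c\<rho>\<close>
  is linear in \<open>\<rho>\<close>.\<close>

lemma prime_dvd_norm_inert:
  fixes p :: int
  assumes p: "prime p" and no_root: "\<And>r. \<not> p dvd cubic_poly r" and dvd: "p dvd cubic_norm x"
  shows "of_int p dvd x"
proof -
  obtain a b c where x: "x = Cubic a b c"
    by (cases x)
  define y where "y = Cubic (c - b) c 0"
  define g e where "g = a * (c - b) + c * c" and "e = a * c + b * (c - b) + 2 * c * c"
  have mult: "x * y = Cubic g e 0"
    by (simp add: cubic_eq_iff cubic_sel_times x y_def g_def e_def algebra_simps)
  then have "p dvd cubic_norm (Cubic g e 0)"
    using dvd by (simp add: cubic_norm_mult flip: mult)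
  then have linear: "of_int p dvd Cubic g e 0"
    by (rule prime_dvd_norm_linear[OF p no_root])
  show ?thesis
  proof (cases "p dvd cubic_norm y")
    case True
    then have "of_int p dvd y"
      unfolding y_def by (rule prime_dvd_norm_linear[OF p no_root])
    then have "p dvd c - b" "p dvd c"
      by (simp_all add: y_def of_int_dvd_cubic_iff)
    then have "p dvd b" "p dvd c"
      using dvd_diff[of p c "c - b"] by simp_all
    then show ?thesis
      using prime_dvd_norm_constant[OF p] dvd by (simp add: x)
  next
    case False
    have "of_int (cubic_norm y) * x = cubic_adj y * Cubic g e 0"
      unfolding cubic_norm_adj mult[symmetric] by (simp only: mult_ac)
    then have "of_int p dvd of_int (cubic_norm y) * x"
      using linear by simp
    then show ?thesis
      using False p by (simp add: of_int_dvd_cubic_iff cubic_sel_times prime_dvd_mult_iff)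
  qed
qed

lemma prime_dvd_norm_split:
  fixes p r :: int
  assumes p: "prime p" and r: "p dvd cubic_poly r" and dvd: "p dvd cubic_norm x"
  obtains s where "p dvd cubic_poly s" "p dvd cubic_eval s x"
proof -
  have roots: "p dvd cubic_poly (conj_root r)" "p dvd cubic_poly (conj_root (conj_root r))"
    using r by (meson cubic_poly_dvd_conj_root dvd_trans)+
  have "p dvd cubic_eval r x * cubic_eval (conj_root r) x
      * cubic_eval (conj_root (conj_root r)) x - cubic_norm x"
    using dvd_trans[OF r cubic_poly_dvd_eval_norm[of r x]] by simp
  then have "p dvd cubic_eval r x * cubic_eval (conj_root r) x
      * cubic_eval (conj_root (conj_root r)) x"
    using dvd by (metis dvd_add_left_iff diff_add_cancel)
  then consider "p dvd cubic_eval r x" | "p dvd cubic_eval (conj_root r) x"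
    | "p dvd cubic_eval (conj_root (conj_root r)) x"
    using p by (auto simp: prime_dvd_mult_iff)
  then show thesis
    using that r roots by cases blast+
qed

lemma dvd_cubic_eval_mult:
  assumes "p dvd cubic_poly r" "p dvd cubic_eval r x"
  shows "p dvd cubic_eval r (a * x)"
proof -
  have "p dvd cubic_eval r a * cubic_eval r x - cubic_eval r (a * x)"
    using assms(1) cubic_poly_dvd_eval_mult by (rule dvd_trans)
  then show ?thesis
    using assms(2) by (metis dvd_diff dvd_mult diff_diff_eq2 add_diff_cancel_left')
qed

lemma cubic_root_ideal_generator:
  fixes p r :: int
  assumes "p dvd cubic_poly r" "\<not> p dvd 1"
  obtains g where "\<not> g dvd 1" "\<And>x. p dvd cubic_eval r x \<Longrightarrow> g dvd x"
proof -
  obtain g where g: "p dvd cubic_eval r g" "\<And>x. p dvd cubic_eval r x \<Longrightarrow> g dvd x"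
    using euclidean_ring_ideal_principal[of "{x. p dvd cubic_eval r x}"]
      dvd_cubic_eval_mult[OF assms(1)]
    by (auto simp: cubic_eval_add)
  have "\<not> g dvd 1"
  proof
    assume "g dvd 1"
    then obtain h where "h * g = 1"
      by (metis dvdE mult.commute)
    then show False
      using dvd_cubic_eval_mult[OF assms(1) g(1), of h] assms(2) by simp
  qed
  with g(2) show thesis
    using that by blast
qed

lemma split_prime_nrd_divisor:
  fixes p r :: int
  assumes p: "prime p" and r: "p dvd cubic_poly r" "p dvd cubic_eval r l" and "l \<noteq> 0"
  obtains x where "nrd x dvd l" "cubic_totpos (nrd x)" "\<not> nrd x dvd 1"
proof -
  obtain g where g: "\<not> g dvd 1" "\<And>x. p dvd cubic_eval r x \<Longrightarrow> g dvd x"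
    using cubic_root_ideal_generator[OF r(1)] p not_prime_unit by blast
  have "g \<noteq> 0"
    using g(2)[OF r(2)] \<open>l \<noteq> 0\<close> by auto
  then obtain e where e: "e dvd 1" "cubic_totpos (e * g)"
    using cubic_totpos_associate by blast
  have associate: "e * g dvd x \<longleftrightarrow> g dvd x" for x
    using e(1) by (simp add: mult_unit_dvd_iff')
  have "e * g dvd cubic_rho - of_int r"
    using g(2) by (simp add: associate cubic_eval_diff)
  then obtain x where "nrd x = e * g"
    using nrd_divisor e(2) by blast
  moreover have "e * g dvd l" "\<not> e * g dvd 1"
    using g r(2) by (simp_all add: associate)
  ultimately show thesis
    using e(2) that by metis
qed

lemma inert_prime_nrd_divisor:
  fixes p :: int
  assumes p: "prime p" and no_root: "\<And>r. \<not> p dvd cubic_poly r" and dvd: "p dvd cubic_norm l"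
  obtains x where "nrd x dvd l" "cubic_totpos (nrd x)" "\<not> nrd x dvd 1"
proof -
  obtain b where "nrd b = p"
    using pos_int_is_nrd[of "nat p"] prime_gt_0_int[OF p] by auto
  then have norm: "nrd (hurwitz_of_int b) = of_int p"
    by (simp add: nrd_hurwitz_of_int)
  have "of_int p dvd l"
    using prime_dvd_norm_inert[OF p no_root dvd] .
  moreover have "cubic_totpos (of_int p)"
    using prime_gt_0_int[OF p] by (simp add: cubic_totpos_def)
  moreover have "\<not> (of_int p :: cubic) dvd 1"
    using of_int_dvd_of_int_cubic_iff[of p 1] not_prime_unit p by auto
  ultimately show thesis
    by (intro that[of "hurwitz_of_int b"]) (simp_all add: norm)
qed

lemma cubic_totpos_nonunit_has_nrd_divisor:
  assumes "cubic_totpos l" "\<not> l dvd 1"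
  obtains x where "nrd x dvd l" "cubic_totpos (nrd x)" "\<not> nrd x dvd 1"
proof -
  have "l \<noteq> 0" "\<bar>cubic_norm l\<bar> \<noteq> 1"
    using assms cubic_totpos_imp(3)[of l] by (auto simp: cubic_is_unit_iff)
  then obtain p where p: "prime p" "p dvd cubic_norm l"
    using prime_divisor_exists[of "cubic_norm l"] by auto
  show thesis
  proof (cases "\<exists>r. p dvd cubic_poly r")
    case True
    then obtain r where "p dvd cubic_poly r" "p dvd cubic_eval r l"
      using prime_dvd_norm_split p by metis
    then show thesis
      using split_prime_nrd_divisor p(1) \<open>l \<noteq> 0\<close> that by blast
  next
    case False
    then show thesis
      using inert_prime_nrd_divisor p that by blast
  qed
qed

theorem cubic_totpos_is_nrd:
  assumes "cubic_totpos l"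
  shows "\<exists>x. nrd x = l"
  using assms
proof (induction "nat (cubic_norm l)" arbitrary: l rule: less_induct)
  case less
  show ?case
  proof (cases "l dvd 1")
    case True
    then have "l dvd cubic_rho - of_int 0"
      by (rule dvd_trans) simp
    then show ?thesis
      using nrd_divisor less.prems by blast
  next
    case False
    then obtain x where x: "nrd x dvd l" "cubic_totpos (nrd x)" "\<not> nrd x dvd 1"
      using cubic_totpos_nonunit_has_nrd_divisor less.prems by blast
    obtain m where m: "l = nrd x * m"
      using x(1) by blast
    then have m_pos: "cubic_totpos m"
      using cubic_totpos_divide less.prems x(2) by blast
    have "cubic_norm (nrd x) > 1" "cubic_norm m > 0"
      using cubic_totpos_imp(3)[OF x(2)] cubic_totpos_imp(3)[OF m_pos] x(3)
      by (auto simp: cubic_is_unit_iff)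
    then have "nat (cubic_norm m) < nat (cubic_norm l)"
      by (simp add: m cubic_norm_mult)
    then obtain y where "nrd y = m"
      using less.hyps m_pos by blast
    then have "nrd (x * y) = l"
      by (simp add: nrd_mult m)
    then show ?thesis
      by blast
  qed
qed

section \<open>Embeddings of integral domains into fields\<close>

lemma is_unit_if_dvd_power_of_coprime:
  fixes a b :: "'a::comm_ring_1"
  assumes "u * a + v * b = 1" "b dvd a ^ d"
  shows "b dvd 1"
  using assms(2)
proof (induction d)
  case (Suc d)
  have "a ^ d = (u * a + v * b) * a ^ d"
    using assms(1) by simp
  also have "\<dots> = u * a ^ Suc d + b * (v * a ^ d)"
    by (simp add: algebra_simps)
  finally have "b dvd a ^ d"
    using Suc.prems by (metis dvd_add dvd_mult dvd_triv_left)
  then show ?case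
    by (rule Suc.IH)
qed simp

lemma ring_of_type_algebra_sel [simp]:
  "carrier (ring_of_type_algebra :: 'a::ring_1 ring) = UNIV"
  "x \<otimes>\<^bsub>(ring_of_type_algebra :: 'a ring)\<^esub> y = x * y"
  "\<one>\<^bsub>(ring_of_type_algebra :: 'a ring)\<^esub> = 1"
  "\<zero>\<^bsub>(ring_of_type_algebra :: 'a ring)\<^esub> = 0"
  "x \<oplus>\<^bsub>(ring_of_type_algebra :: 'a ring)\<^esub> y = x + y"
  by (simp_all add: ring_of_type_algebra_def)

lemma a_inv_ring_of_type_algebra:
  "\<ominus>\<^bsub>(ring_of_type_algebra :: 'a::comm_ring_1 ring)\<^esub> x = - x"
proof -
  interpret cring "ring_of_type_algebra :: 'a ring"
    by (rule cring_from_type_algebra)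
  show ?thesis
    by (rule minus_equality) simp_all
qed

lemma m_inv_ring_of_type_algebra:
  fixes x :: "'a::field"
  assumes "x \<noteq> 0"
  shows "inv\<^bsub>(ring_of_type_algebra :: 'a ring)\<^esub> x = inverse x"
proof -
  interpret cring "ring_of_type_algebra :: 'a ring"
    by (rule cring_from_type_algebra)
  show ?thesis
    using assms by (intro comm_inv_char) simp_all
qed

locale ring_embedding =
  fixes f :: "'a::idom \<Rightarrow> 'b::field"
  assumes hom_add: "f (x + y) = f x + f y"
    and hom_mult: "f (x * y) = f x * f y"
    and hom_1 [simp]: "f 1 = 1"
    and kernel: "f x = 0 \<Longrightarrow> x = 0"
begin

lemma hom_diff: "f (x - y) = f x - f y"
  using hom_add[of "x - y" y] by simp

lemma hom_0 [simp]: "f 0 = 0"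
  using hom_diff[of 0 0] by simp

lemma hom_uminus: "f (- x) = - f x"
  using hom_diff[of 0 x] by simp

lemma hom_eq_0_iff [simp]: "f x = 0 \<longleftrightarrow> x = 0"
  using kernel by auto

lemma hom_eq_iff: "f x = f y \<longleftrightarrow> x = y"
  using hom_eq_0_iff[of "x - y"] by (simp add: hom_diff)

lemma hom_power: "f (x ^ n) = f x ^ n"
  by (induction n) (simp_all add: hom_mult)

lemma hom_sum: "f (sum g A) = (\<Sum>i\<in>A. f (g i))"
  by (induction A rule: infinite_finite_induct) (simp_all add: hom_add)

lemma hom_of_nat: "f (of_nat n) = of_nat n"
  by (induction n) (simp_all add: hom_add)

lemma hom_of_int: "f (of_int k) = of_int k"
  by (cases k) (simp_all add: hom_of_nat hom_uminus hom_diff)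

definition fractions :: "'b set" where
  "fractions = {f x / f y | x y. y \<noteq> 0}"

lemma fractionsI: "y \<noteq> 0 \<Longrightarrow> f x / f y \<in> fractions"
  by (auto simp: fractions_def)

lemma fractionsE:
  assumes "z \<in> fractions"
  obtains x y where "y \<noteq> 0" "z = f x / f y"
  using assms by (auto simp: fractions_def)

lemma add_fractions:
  "y \<noteq> 0 \<Longrightarrow> y' \<noteq> 0 \<Longrightarrow> f x / f y + f x' / f y' = f (x * y' + x' * y) / f (y * y')"
  by (simp add: hom_add hom_mult add_frac_eq)

lemma generate_field_subset_fractions:
  assumes "S \<subseteq> fractions"
  shows "generate_field (ring_of_type_algebra :: 'b ring) S \<subseteq> fractions"
proof
  fix z assume "z \<in> generate_field (ring_of_type_algebra :: 'b ring) S"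
  then show "z \<in> fractions"
  proof (induction rule: generate_field.induct)
    case one
    show ?case
      using fractionsI[of 1 1] by simp
  next
    case (incl h)
    with assms show ?case
      by blast
  next
    case (a_inv h)
    then obtain x y where "y \<noteq> 0" "h = f x / f y"
      by (blast elim: fractionsE)
    then show ?case
      using fractionsI[of y "- x"] by (simp add: a_inv_ring_of_type_algebra hom_uminus)
  next
    case (m_inv h)
    then obtain x y where "y \<noteq> 0" "h = f x / f y"
      by (blast elim: fractionsE)
    with m_inv show ?case
      using fractionsI[of x y] by (simp add: m_inv_ring_of_type_algebra)
  next
    case (eng_add h1 h2)
    then obtain x y x' y' where "y \<noteq> 0" "h1 = f x / f y" "y' \<noteq> 0" "h2 = f x' / f y'"
      by (blast elim: fractionsE)
    then show ?case
      using fractionsI[of "y * y'" "x * y' + x' * y"] by (simp add: add_fractions)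
  next
    case (eng_mult h1 h2)
    then obtain x y x' y' where "y \<noteq> 0" "h1 = f x / f y" "y' \<noteq> 0" "h2 = f x' / f y'"
      by (blast elim: fractionsE)
    then show ?case
      using fractionsI[of "y * y'" "x * x'"] by (simp add: hom_mult)
  qed
qed

lemma denominator_dvd_power_of_numerator:
  assumes "b \<noteq> 0" "poly (map_poly of_int p) (f a / f b) = 0" "lead_coeff p = 1"
  shows "b dvd a ^ degree p"
proof -
  define d where "d = degree p"
  have "f (\<Sum>i\<le>d. of_int (coeff p i) * a ^ i * b ^ (d - i)) =
      (\<Sum>i\<le>d. of_int (coeff p i) * (f a / f b) ^ i) * f b ^ d"
    using assms(1) unfolding hom_sum sum_distrib_right
    by (intro sum.cong)
      (auto simp: hom_mult hom_power hom_of_int power_divide power_diff)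
  also have "(\<Sum>i\<le>d. of_int (coeff p i) * (f a / f b) ^ i) = poly (map_poly of_int p) (f a / f b)"
    using assms(3) by (simp add: poly_altdef d_def map_poly_degree_eq coeff_map_poly)
  finally have "(\<Sum>i\<le>d. of_int (coeff p i) * a ^ i * b ^ (d - i)) = 0"
    using assms(2) by simp
  then have "a ^ d = - (\<Sum>i<d. of_int (coeff p i) * a ^ i * b ^ (d - i))"
    using assms(3) unfolding lessThan_Suc_atMost[symmetric] sum.lessThan_Suc
    by (simp add: d_def eq_neg_iff_add_eq_0 add.commute)
  moreover have "b dvd (\<Sum>i<d. of_int (coeff p i) * a ^ i * b ^ (d - i))"
    by (rule dvd_sum) (simp add: dvd_mult dvd_power)
  ultimately show ?thesis
    by (simp add: d_def)
qed

end

theorem euclidean_ring_integrally_closed: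
  fixes f :: "'a::euclidean_ring \<Rightarrow> 'b::field_char_0"
  assumes "ring_embedding f" "x \<in> ring_embedding.fractions f" "algebraic_int x"
  shows "x \<in> range f"
proof -
  interpret ring_embedding f by fact
  obtain a b where ab: "b \<noteq> 0" "x = f a / f b"
    using assms(2) by (blast elim: fractionsE)
  obtain g u v where g: "g = u * a + v * b" "g dvd a" "g dvd b"
    using euclidean_ring_bezout .
  obtain a' b' where a': "a = g * a'" and b': "b = g * b'"
    using g(2,3) by (metis dvdE)
  have "g * (u * a' + v * b') = u * (g * a') + v * (g * b')"
    by (simp add: algebra_simps)
  also have "\<dots> = g * 1"
    by (simp flip: a' b' g(1))
  finally have coprime: "u * a' + v * b' = 1"
    using ab(1) b' by auto
  have x: "x = f a' / f b'" and "b' \<noteq> 0"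
    using ab by (auto simp: a' b' hom_mult)
  obtain p where "poly (map_poly of_int p) x = 0" "lead_coeff p = 1"
    using assms(3) unfolding algebraic_int_altdef_ipoly by blast
  then have "b' dvd 1"
    using denominator_dvd_power_of_numerator[OF \<open>b' \<noteq> 0\<close>]
      is_unit_if_dvd_power_of_coprime[OF coprime]
    unfolding x by blast
  then obtain c where "1 = b' * c"
    by blast
  then have "f b' * f c = 1"
    by (metis hom_1 hom_mult)
  then have "x = f (a' * c)"
    using \<open>b' \<noteq> 0\<close> by (simp add: x hom_mult field_simps)
  then show ?thesis
    by blast
qed

lemma fraction_map_exists:
  fixes f :: "'a::idom \<Rightarrow> 'b::field" and g :: "'a \<Rightarrow> 'c::field"
  assumes "ring_embedding f" "ring_embedding g"
  obtains \<sigma> where "\<And>x y. y \<noteq> 0 \<Longrightarrow> \<sigma> (f x / f y) = g x / g y"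
proof
  interpret f: ring_embedding f by fact
  interpret g: ring_embedding g by fact
  define \<sigma> where "\<sigma> z = (SOME w. \<exists>x y. y \<noteq> 0 \<and> z = f x / f y \<and> w = g x / g y)" for z
  fix x y :: 'a
  assume "y \<noteq> 0"
  have "\<exists>x' y'. y' \<noteq> 0 \<and> f x / f y = f x' / f y' \<and> \<sigma> (f x / f y) = g x' / g y'"
    unfolding \<sigma>_def by (rule someI_ex) (use \<open>y \<noteq> 0\<close> in blast)
  then obtain x' y' where "y' \<noteq> 0" and eq: "f x / f y = f x' / f y'" "\<sigma> (f x / f y) = g x' / g y'"
    by blast
  have "f (x * y') = f (x' * y)"
    using eq(1) \<open>y \<noteq> 0\<close> \<open>y' \<noteq> 0\<close> by (simp add: f.hom_mult frac_eq_eq)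
  then have "g x / g y = g x' / g y'"
    using \<open>y \<noteq> 0\<close> \<open>y' \<noteq> 0\<close> by (simp add: f.hom_eq_iff frac_eq_eq flip: g.hom_mult)
  with eq(2) show "\<sigma> (f x / f y) = g x / g y"
    by simp
qed

theorem embedding_extends_to_fractions:
  fixes f :: "'a::idom \<Rightarrow> 'b::field" and g :: "'a \<Rightarrow> 'c::field"
  assumes "ring_embedding f" "ring_embedding g" and K: "1 \<in> K" "K \<subseteq> ring_embedding.fractions f"
  obtains \<sigma> where "\<sigma> \<in> ring_hom (ring_of_type_algebra\<lparr>carrier := K\<rparr>) ring_of_type_algebra"
    "\<And>x. \<sigma> (f x) = g x"
proof -
  interpret f: ring_embedding f by fact
  interpret g: ring_embedding g by fact
  obtain \<sigma> where \<sigma>: "\<And>x y. y \<noteq> 0 \<Longrightarrow> \<sigma> (f x / f y) = g x / g y"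
    using fraction_map_exists[OF assms(1,2)] by blast
  have \<sigma>_f: "\<sigma> (f x) = g x" for x
    using \<sigma>[of 1 x] by simp
  have "\<sigma> (z + z') = \<sigma> z + \<sigma> z'" "\<sigma> (z * z') = \<sigma> z * \<sigma> z'" if "z \<in> K" "z' \<in> K" for z z'
  proof -
    obtain x y x' y' where z: "y \<noteq> 0" "z = f x / f y" "y' \<noteq> 0" "z' = f x' / f y'"
      using \<open>z \<in> K\<close> \<open>z' \<in> K\<close> K(2) by (meson f.fractionsE subsetD)
    then show "\<sigma> (z + z') = \<sigma> z + \<sigma> z'" "\<sigma> (z * z') = \<sigma> z * \<sigma> z'"
      using \<sigma>[of "y * y'" "x * y' + x' * y"] \<sigma>[of "y * y'" "x * x'"]
      by (simp_all add: f.add_fractions g.add_fractions \<sigma> f.hom_mult g.hom_mult)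
  qed
  moreover have "\<sigma> 1 = 1"
    using \<sigma>_f[of 1] by simp
  ultimately have "\<sigma> \<in> ring_hom (ring_of_type_algebra\<lparr>carrier := K\<rparr>) ring_of_type_algebra"
    using K(1) by (intro ring_hom_memI) simp_all
  with \<sigma>_f show thesis
    using that by blast
qed

section \<open>The field generated by \<open>\<rho>\<close>\<close>

lemma cubic_eval_embedding:
  fixes r :: "'a::field_char_0"
  assumes "cubic_poly r = 0"
  shows "ring_embedding (cubic_eval r)"
  using assms by unfold_locales (simp_all add: cubic_eval_add cubic_eval_mult cubic_eval_eq_0_iff)

lemma algebraic_int_cubic_eval:
  fixes r :: "'a::field_char_0"
  assumes r: "cubic_poly r = 0"
  shows "algebraic_int (cubic_eval r w)"
proof -
  define p where "p = [:- cubic_norm w, cubic_sym2 w, - cubic_trace w, 1:]"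
  have "poly (map_poly of_int p) (cubic_eval r w) = 0"
    by (simp add: p_def map_poly_pCons cubic_eval_norm[OF r] cubic_eval_sym2[OF r]
        cubic_eval_trace[OF r] algebra_simps)
  moreover have "lead_coeff p = 1"
    by (simp add: p_def)
  ultimately show ?thesis
    unfolding algebraic_int_altdef_ipoly by blast
qed

lemma rat_adjoin_subset_fractions:
  assumes r: "cubic_poly r = 0"
  shows "rat_adjoin r \<subseteq> ring_embedding.fractions (cubic_eval r)"
proof -
  interpret ring_embedding "cubic_eval r"
    using r by (rule cubic_eval_embedding)
  have "r \<in> fractions"
    using fractionsI[of 1 cubic_rho] by simp
  moreover have "x \<in> fractions" if rational: "x \<in> \<rat>" for x
  proof -
    obtain a b :: int where "b > 0" "x = of_int a / of_int b"
      using rational by (metis Rats_cases')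
    then show ?thesis
      using fractionsI[of "of_int b" "of_int a"] by simp
  qed
  ultimately show ?thesis
    unfolding rat_adjoin_def by (intro generate_field_subset_fractions) auto
qed

lemma rat_adjoin_closed:
  assumes "x \<in> rat_adjoin a" "y \<in> rat_adjoin a"
  shows "x + y \<in> rat_adjoin a" "x * y \<in> rat_adjoin a"
  using generate_field.eng_add[OF assms[unfolded rat_adjoin_def]]
    generate_field.eng_mult[OF assms[unfolded rat_adjoin_def]]
  by (simp_all add: rat_adjoin_def)

lemma cubic_eval_in_rat_adjoin: "cubic_eval r v \<in> rat_adjoin r"
proof -
  have incl: "x \<in> rat_adjoin r" if "x \<in> \<rat> \<union> {r}" for x
    unfolding rat_adjoin_def using that by (rule generate_field.incl)
  show ?thesis
    unfolding cubic_eval_def power2_eq_square by (intro rat_adjoin_closed incl) simp_all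
qed

lemma ring_of_integers_rat_adjoin:
  assumes r: "cubic_poly r = 0"
  shows "ring_of_integers (rat_adjoin r) = range (cubic_eval r)"
  using algebraic_int_cubic_eval[OF r] cubic_eval_in_rat_adjoin rat_adjoin_subset_fractions[OF r]
    euclidean_ring_integrally_closed[OF cubic_eval_embedding[OF r]]
  by (auto simp: ring_of_integers_def)

lemma totally_positive_imp_cubic_totpos:
  assumes r: "cubic_poly r = 0" and pos: "totally_positive (rat_adjoin r) (cubic_eval r v)"
  shows "cubic_totpos v"
  unfolding cubic_totpos_def
proof (intro allI impI)
  fix s :: real
  assume s: "cubic_poly s = 0"
  have "1 \<in> rat_adjoin r"
    using cubic_eval_in_rat_adjoin[of r 1] by simp
  then obtain \<sigma> where "\<sigma> \<in> real_embeddings (rat_adjoin r)" "\<And>x. \<sigma> (cubic_eval r x) = cubic_eval s x"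
    using embedding_extends_to_fractions[OF cubic_eval_embedding[OF r] cubic_eval_embedding[OF s] _
        rat_adjoin_subset_fractions[OF r]]
    unfolding real_embeddings_def by blast
  then show "cubic_eval s v > 0"
    using pos unfolding totally_positive_def by metis
qed

lemma cubic_poly_seventh_root_of_unity:
  fixes \<zeta> :: "'a::field"
  assumes "primitive_root_of_unity 7 \<zeta>"
  shows "cubic_poly (\<zeta> + inverse \<zeta>) = 0"
proof -
  have "\<zeta> ^ 7 = 1" and "\<zeta> \<noteq> 1"
    using assms by (auto simp: primitive_root_of_unity_def dest!: spec[of _ 1])
  then have "\<zeta> \<noteq> 0"
    by auto
  have "(\<zeta> - 1) * (\<zeta>^6 + \<zeta>^5 + \<zeta>^4 + \<zeta>^3 + \<zeta>\<^sup>2 + \<zeta> + 1) = \<zeta> ^ 7 - 1"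
    by (simp add: algebra_simps eval_nat_numeral)
  then have sum: "\<zeta>^6 + \<zeta>^5 + \<zeta>^4 + \<zeta>^3 + \<zeta>\<^sup>2 + \<zeta> + 1 = 0"
    using \<open>\<zeta> ^ 7 = 1\<close> \<open>\<zeta> \<noteq> 1\<close> by simp
  define t where "t = \<zeta> + inverse \<zeta>"
  have t: "\<zeta> * t = \<zeta>\<^sup>2 + 1"
    using \<open>\<zeta> \<noteq> 0\<close> by (simp add: t_def distrib_left power2_eq_square)
  have "\<zeta>^3 * cubic_poly t = (\<zeta> * t)^3 + \<zeta> * (\<zeta> * t)\<^sup>2 - 2 * \<zeta>\<^sup>2 * (\<zeta> * t) - \<zeta>^3"
    by (simp add: cubic_poly_def algebra_simps eval_nat_numeral)
  also have "\<dots> = \<zeta>^6 + \<zeta>^5 + \<zeta>^4 + \<zeta>^3 + \<zeta>\<^sup>2 + \<zeta> + 1"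
    unfolding t by (simp add: algebra_simps eval_nat_numeral)
  finally show ?thesis
    using \<open>\<zeta> \<noteq> 0\<close> sum by (simp add: t_def)
qed

theorem theorem6p2:
  fixes \<zeta> :: complex and K :: "complex set"
  assumes "primitive_root_of_unity 7 \<zeta>"
    and "K = rat_adjoin (\<zeta> + inverse \<zeta>)"
  shows "\<forall>l\<in>ring_of_integers K. totally_positive K l \<longrightarrow>
    (\<exists>x\<in>ring_of_integers K. \<exists>y\<in>ring_of_integers K.
     \<exists>z\<in>ring_of_integers K. \<exists>w\<in>ring_of_integers K.
       x\<^sup>2 + x * y + y\<^sup>2 + y * z - x * w + z\<^sup>2 + z * w + w\<^sup>2 = l)"
proof (intro ballI impI)
  fix l assume l: "l \<in> ring_of_integers K" "totally_positive K l"
  define r where "r = \<zeta> + inverse \<zeta>"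
  have r: "cubic_poly r = 0"
    unfolding r_def using assms(1) by (rule cubic_poly_seventh_root_of_unity)
  have integers: "ring_of_integers K = range (cubic_eval r)"
    using ring_of_integers_rat_adjoin[OF r] assms(2) by (simp add: r_def)
  then have integral: "cubic_eval r u \<in> ring_of_integers K" for u
    by simp
  obtain v where v: "l = cubic_eval r v"
    using l(1) by (auto simp: integers)
  then have "cubic_totpos v"
    using totally_positive_imp_cubic_totpos[OF r] l(2) assms(2) by (simp add: r_def)
  then obtain q where "nrd q = v"
    using cubic_totpos_is_nrd by blast
  then have "nrd (map_hurwitz (cubic_eval r) q) = l"
    using cubic_eval_nrd[OF r, of q] by (simp add: v)
  then show "\<exists>x\<in>ring_of_integers K. \<exists>y\<in>ring_of_integers K.
     \<exists>z\<in>ring_of_integers K. \<exists>w\<in>ring_of_integers K.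
       x\<^sup>2 + x * y + y\<^sup>2 + y * z - x * w + z\<^sup>2 + z * w + w\<^sup>2 = l"
    using integral unfolding nrd_def map_hurwitz_sel by blast
qed

end
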